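(* Let $\Sigma\in\mathbb{R}^{N_x\times N_x}$, $\Sigma\succ 0$, let the disturbance trajectory $w$ have support $\mathcal{W}=\{z\in\mathbb{R}^{N_x} : z^\top\Sigma^{-1}z\le 1\}$, and let the primitive disturbance trajectory $\xi$ be an independent and identically distributed copy of $w$ (so its support is $\Xi=\mathcal{W}$). Consider the semidefinite program (S) in the decision variables $Q^w\in\mathcal{Q}_N$, $Q^\xi\in\mathcal{Q}_C$, $Y\in\mathcal{Y}(G_C)$, $\overline{u}\in\mathbb{R}^{N_u}$, $P^w,P^\xi\in\mathbb{R}^{N_x\times N_x}$, $\overline{v},\overline{x}\in\mathbb{R}^{N_x}$, $\lambda,\beta\in\mathbb{R}_+$: minimize $$\mathrm{Tr}\big({P^\xi}^\top R_xP^\xi M+{P^w}^\top R_xP^wM\big)+\overline{x}^\top R_x\overline{x}+\mathrm{Tr}\big({Q^w}^\top R_uQ^wM+{Q^\xi}^\top R_uQ^\xi M\big)+\overline{u}^\top R_u\overline{u}$$ subject to $\lambda\ge\max\{1,\beta\}$ and $$\overline{x}=\widetilde{B}\,\overline{u}+\widetilde{H}\,\Pi_{\mathcal{C}}\overline{v},\qquad P^w=\widetilde{B}Q^w+\widetilde{L},\qquad P^\xi=\widetilde{B}Q^\xi+\widetilde{H}\,\Pi_{\mathcal{C}}(\lambda I-Y),$$ $$\big\|\Sigma^{1/2}(F_xP^w+F_uQ^w+F_w)^\top e_i\big\|_2+\big\|\Sigma^{1/2}(F_xP^\xi+F_uQ^\xi)^\top e_i\big\|_2\le e_i^\top(g-F_x\overline{x}-F_u\overline{u}),\quad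 i=1,\dots,m,$$ $$\Pi_{\mathcal{C}}(\overline{x}-\overline{v})=0,$$ $$\begin{bmatrix}\Pi_{\mathcal{C}}\widetilde{\Sigma}\Pi_{\mathcal{C}}^\top & \Pi_{\mathcal{C}}P^w & \Pi_{\mathcal{C}}P^\xi\\ {P^w}^\top\Pi_{\mathcal{C}}^\top & \beta\Sigma^{-1} & 0\\ {P^\xi}^\top\Pi_{\mathcal{C}}^\top & 0 & (\lambda-\beta)\Sigma^{-1}\end{bmatrix}\succeq 0,\qquad \widetilde{\Sigma}:=\lambda\Sigma-Y\Sigma-\Sigma Y^\top,$$ where $e_i\in\mathbb{R}^m$ is the $i$th standard basis vector. Then (S) is a conservative approximation of the policy-contract optimization problem (J) defined in the context. That is, for every feasible point of (S), the tuple $(Q^w,Q^\xi,Z,\overline{u},\overline{v})$ with $Z=\lambda I-Y$ is feasible for (J), and the objective value of (J) at this tuple equals the objective value of (S) at the given point.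
   Context: System. There are $N$ subsystems indexed by $V=\{1,\dots,N\}$ and a finite horizon $T\ge 1$. Subsystem $i$ has state $x_i(t)\in\mathbb{R}^{n_x^i}$, input $u_i(t)\in\mathbb{R}^{n_u^i}$, disturbance $w_i(t)\in\mathbb{R}^{n_x^i}$, with $$x_i(t+1)=\sum_{j=1}^N\big(A_{ij}(t)x_j(t)+B_{ij}(t)u_j(t)\big)+w_i(t),\quad t=0,\dots,T-1.$$ Put $n_x=\sum_i n_x^i$, $n_u=\sum_i n_u^i$, $N_x=n_x(T+1)$, $N_u=n_uT$, $w(-1):=x(0)$, $x=(x(0),\dots,x(T))\in\mathbb{R}^{N_x}$, $u=(u(0),\dots,u(T-1))\in\mathbb{R}^{N_u}$, $w=(w(-1),w(0),\dots,w(T-1))\in\mathbb{R}^{N_x}$, where $x(t),u(t),w(t)$ stack the subsystem components. The disturbance trajectory $w$ is a zero-mean random vector with second moment matrix $M=\mathbb{E}[ww^\top]$ and support $\mathcal{W}$. Given data: $F_x\in\mathbb{R}^{m\times N_x}$, $F_u\in\mathbb{R}^{m\times N_u}$, $F_w\in\mathbb{R}^{m\times N_x}$, $g\in\mathbb{R}^m$, and symmetric positive semidefinite $R_x\in\mathbb{R}^{N_x\times N_x}$, $R_u\in\mathbb{R}^{N_u\times N_u}$. Vector inequalities are componentwise. Information structure. A directed graph $G_I=(V,E_I)$ is given; $(j,i)\in E_I$ means subsystem $i$ measures $x_j$. Let $V_I^-(i)=\{j:(j,i)\in E_I\}$, $V_A^-(i)=\{j:\exists t\in\{0,\dots,T-1\},\,A_{ij}(t)\ne0\}$,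 $V_B^-(i)=\{j:\exists t\in\{0,\dots,T-1\},\,B_{ij}(t)\neq0\}$. Define $$\mathcal{N}(i)=\Big\{j\in V_I^-(i): V_A^-(j)\subseteq V_I^-(i),\ \bigcup_{k\in V_B^-(j)}V_I^-(k)\subseteq V_I^-(i)\Big\},\qquad \mathcal{C}(i)=V_I^-(i)\setminus\mathcal{N}(i),\qquad \mathcal{C}=\bigcup_{i\in V}\mathcal{C}(i).$$ For a trajectory $x\in\mathbb{R}^{N_x}$, $x_{\mathcal{C}}=\Pi_{\mathcal{C}}x\in\mathbb{R}^{N_x^{\mathcal{C}}}$ denotes the subvector $(x_{\mathcal{C}}(0),\dots,x_{\mathcal{C}}(T))$, where $x_{\mathcal{C}}(t)$ stacks $x_j(t)$, $j\in\mathcal{C}$, in ascending order; $\Pi_{\mathcal{C}}$ is the corresponding coordinate-projection matrix. Surrogate dynamics. Given $\widetilde{u}\in\mathbb{R}^{N_u}$, $w\in\mathbb{R}^{N_x}$, $v\in\mathbb{R}^{N_x}$ (fictitious disturbance, $v=(v(0),\dots,v(T))$, $v_{\mathcal{C}}=\Pi_{\mathcal{C}}v$), the surrogate state $\widetilde{x}$ satisfies $\widetilde{x}(0)=w(-1)$ and $$\widetilde{x}_i(t+1)=\sum_{j\in V\setminus\mathcal{C}(i)}A_{ij}(t)\widetilde{x}_j(t)+\sum_{j\in\mathcal{C}(i)}A_{ij}(t)v_j(t)+\sum_{j=1}^NB_{ij}(t)\widetilde{u}_j(t)+w_i(t).$$ The matrices $\widetilde{B},\widetilde{L},\widetilde{H}$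 are those for which this reads $\widetilde{x}=\widetilde{B}\widetilde{u}+\widetilde{L}w+\widetilde{H}v_{\mathcal{C}}$. Matrix subspaces. $\mathcal{Q}_N$ (resp. $\mathcal{Q}_C$) is the set of matrices $Q\in\mathbb{R}^{N_u\times N_x}$, viewed as $T\times(T+1)$ block matrices with blocks $Q(t,s)\in\mathbb{R}^{n_u\times n_x}$ ($0\le t\le T-1$, $0\le s\le T$), each subdivided into $N\times N$ blocks $[Q(t,s)]_{ij}\in\mathbb{R}^{n_u^i\times n_x^j}$, such that $[Q(t,s)]_{ij}=0$ unless $t\ge s$ and $j\in\mathcal{N}(i)$ (resp. unless $t\ge s$ and $j\in\mathcal{C}(i)$). The information coupling graph $G_C=(V,E_C)$ has $E_C=\{(j,i)\in E_I: j\in\mathcal{C}(i)\}$, with out-neighborhoods $V_C^+(j)=\{i:(j,i)\in E_C\}$. $\mathcal{Y}(G_C)$ is the subspace of $Y\in\mathbb{R}^{N_x\times N_x}$, viewed as $(T+1)\times(T+1)$ block matrices with blocks $Y(t,s)\in\mathbb{R}^{n_x\times n_x}$ subdivided into blocks $[Y(t,s)]_{ij}\in\mathbb{R}^{n_x^i\times n_x^j}$, that are strictly block lower triangular ($Y(t,s)=0$ for $t\le s$) and satisfy $[Y(t,s)]_{ij}=0$ whenever $V_C^+(i)\nsubseteq V_C^+(j)$. $\mathcal{Z}$ is the set of lower triangular invertible matrices in $\mathbb{R}^{N_x\times N_x}$. For sets, $\oplus$ is Minkowski sum, and a vector is identified with the corresponding singleton. Problem (J): minimize $\mathbb{E}[\widetilde{x}^\top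 R_x\widetilde{x}+\widetilde{u}^\top R_u\widetilde{u}]$ over $Q^w\in\mathcal{Q}_N$, $Q^\xi\in\mathbb{R}^{N_u\times N_x}$, $Z\in\mathcal{Z}$, $\overline{u}\in\mathbb{R}^{N_u}$, $\overline{v}\in\mathbb{R}^{N_x}$ subject to $Q^\xi Z^{-1}\in\mathcal{Q}_C$ and, for all $(w,\xi)\in\mathcal{W}\times\Xi$, with $v=\overline{v}+Z\xi$, $\widetilde{u}=\overline{u}+Q^ww+Q^\xi\xi$, $\widetilde{x}=\widetilde{B}\widetilde{u}+\widetilde{L}w+\widetilde{H}v_{\mathcal{C}}$: $$\Pi_{\mathcal{C}}\widetilde{x}\in\Pi_{\mathcal{C}}(\overline{v}\oplus Z\mathcal{W}),\qquad F_x\widetilde{x}+F_u\widetilde{u}+F_ww\le g.$$ *)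

theory Defs
  imports
    "HOL-Probability.Probability"
    "Jordan_Normal_Form.Matrix"
    "Jordan_Normal_Form.Gauss_Jordan_Elimination"
begin

no_notation Finite_Cartesian_Product.vec_nth (infixl "$" 90)
no_notation Inner_Product.real_inner_class.inner (infix "\<bullet>" 70)
hide_const (open) Finite_Cartesian_Product.vec Finite_Cartesian_Product.mat

definition norm2 :: "real vec \<Rightarrow> real" where
  "norm2 x = sqrt (x \<bullet> x)"

definition tr :: "real mat \<Rightarrow> real" where
  "tr A = (\<Sum>i<dim_row A. A $$ (i, i))"

definition psd :: "nat \<Rightarrow> real mat \<Rightarrow> bool" where
  "psd n A \<longleftrightarrow> A \<in> carrier_mat n n \<and> A\<^sup>T = A
     \<and> (\<forall>x\<in>carrier_vec n. 0 \<le> x \<bullet> (A *\<^sub>v x))"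

definition pos_def :: "nat \<Rightarrow> real mat \<Rightarrow> bool" where
  "pos_def n A \<longleftrightarrow> A \<in> carrier_mat n n \<and> A\<^sup>T = A
     \<and> (\<forall>x\<in>carrier_vec n. x \<noteq> 0\<^sub>v n \<longrightarrow> 0 < x \<bullet> (A *\<^sub>v x))"

definition psd_sqrt :: "nat \<Rightarrow> real mat \<Rightarrow> real mat" where
  "psd_sqrt n A = (THE S. psd n S \<and> S * S = A)"

text \<open>Only meaningful for invertible matrices; \<open>mat_inverse\<close> returns \<open>None\<close> otherwise.\<close>

definition minv :: "real mat \<Rightarrow> real mat" where
  "minv A = the (mat_inverse A)"

definition append_cols :: "real mat \<Rightarrow> real mat \<Rightarrow> real mat" where
  "append_cols A B = four_block_mat A B (0\<^sub>m 0 (dim_col A)) (0\<^sub>m 0 (dim_col B))"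

definition lower_triangular :: "real mat \<Rightarrow> bool" where
  "lower_triangular A \<longleftrightarrow> (\<forall>i<dim_row A. \<forall>j<dim_col A. i < j \<longrightarrow> A $$ (i, j) = 0)"

definition ellipsoid :: "nat \<Rightarrow> real mat \<Rightarrow> real vec set" where
  "ellipsoid n A = {z \<in> carrier_vec n. z \<bullet> (minv A *\<^sub>v z) \<le> 1}"

text \<open>The Borel sigma-algebra on \<open>carrier_vec n\<close>, transported from the product space.\<close>

definition vec_borel :: "nat \<Rightarrow> real vec measure" where
  "vec_borel n = vimage_algebra (carrier_vec n) (\<lambda>x. \<lambda>i\<in>{..<n}. x $ i) (PiM {..<n} (\<lambda>_. borel))"

text \<open>The topological support of the law of \<open>X\<close>: all points each of whose balls is charged.\<close>

definition vec_support :: "nat \<Rightarrow> 'a measure \<Rightarrow> ('a \<Rightarrow> real vec) \<Rightarrow> real vec set" where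
  "vec_support n Pr X = {z \<in> carrier_vec n.
     \<forall>\<epsilon>>0. 0 < measure (distr Pr (vec_borel n) X) {y \<in> carrier_vec n. norm2 (y - z) < \<epsilon>}}"

definition zero_mean :: "nat \<Rightarrow> 'a measure \<Rightarrow> ('a \<Rightarrow> real vec) \<Rightarrow> bool" where
  "zero_mean n Pr X \<longleftrightarrow>
     (\<forall>i<n. integrable Pr (\<lambda>\<omega>. X \<omega> $ i) \<and> (\<integral>\<omega>. X \<omega> $ i \<partial>Pr) = 0)"

definition second_moment :: "nat \<Rightarrow> 'a measure \<Rightarrow> ('a \<Rightarrow> real vec) \<Rightarrow> real mat" where
  "second_moment n Pr X = mat n n (\<lambda>(i, j). \<integral>\<omega>. X \<omega> $ i * X \<omega> $ j \<partial>Pr)"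

text \<open>
  \<open>Ablk S t i j\<close> and \<open>Bblk S t i j\<close> map the state and input of subsystem \<open>j\<close> at time \<open>t\<close> to the state
  of subsystem \<open>i\<close> at time \<open>t + 1\<close>. An edge \<open>(j, i)\<close> in \<open>EI S\<close> means that \<open>i\<close> measures the state
  of \<open>j\<close>. The fields from \<open>ncon\<close> on are the data of the optimization problems (number of
  constraints, constraint data, cost weights).
\<close>

record netsys =
  nsub :: nat
  hor :: nat
  xdim :: "nat \<Rightarrow> nat"
  udim :: "nat \<Rightarrow> nat"
  Ablk :: "nat \<Rightarrow> nat \<Rightarrow> nat \<Rightarrow> real mat"
  Bblk :: "nat \<Rightarrow> nat \<Rightarrow> nat \<Rightarrow> real mat"
  EI :: "(nat \<times> nat) set"
  ncon :: nat
  Fx :: "real mat"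
  Fu :: "real mat"
  Fw :: "real mat"
  gvec :: "real vec"
  Rx :: "real mat"
  Ru :: "real mat"

definition subsys :: "netsys \<Rightarrow> nat set" where
  "subsys S = {1..nsub S}"

definition Nx :: "netsys \<Rightarrow> nat" where
  "Nx S = (\<Sum>i\<in>subsys S. xdim S i) * (hor S + 1)"

definition Nu :: "netsys \<Rightarrow> nat" where
  "Nu S = (\<Sum>i\<in>subsys S. udim S i) * hor S"

definition netsys_ok :: "netsys \<Rightarrow> bool" where
  "netsys_ok S \<longleftrightarrow> 1 \<le> nsub S \<and> 1 \<le> hor S
     \<and> (\<forall>t<hor S. \<forall>i\<in>subsys S. \<forall>j\<in>subsys S.
          Ablk S t i j \<in> carrier_mat (xdim S i) (xdim S j)
        \<and> Bblk S t i j \<in> carrier_mat (xdim S i) (udim S j))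
     \<and> EI S \<subseteq> subsys S \<times> subsys S
     \<and> Fx S \<in> carrier_mat (ncon S) (Nx S)
     \<and> Fu S \<in> carrier_mat (ncon S) (Nu S)
     \<and> Fw S \<in> carrier_mat (ncon S) (Nx S)
     \<and> gvec S \<in> carrier_vec (ncon S)
     \<and> psd (Nx S) (Rx S) \<and> psd (Nu S) (Ru S)"

text \<open>
  Position, inside a stacked trajectory with subsystem dimensions \<open>d\<close>, of entry \<open>a\<close> (counted from 0)
  of the component of subsystem \<open>i\<close> at the \<open>t\<close>-th time block. Block \<open>t\<close> of a disturbance trajectory
  holds \<open>w(t - 1)\<close>, where \<open>w(-1) = x(0)\<close>.
\<close>

definition pos :: "netsys \<Rightarrow> (nat \<Rightarrow> nat) \<Rightarrow> nat \<Rightarrow> nat \<Rightarrow> nat \<Rightarrow> nat" where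
  "pos S d t i a = t * (\<Sum>k\<in>subsys S. d k) + (\<Sum>k\<in>{1..<i}. d k) + a"

definition vblk :: "netsys \<Rightarrow> (nat \<Rightarrow> nat) \<Rightarrow> real vec \<Rightarrow> nat \<Rightarrow> nat \<Rightarrow> real vec" where
  "vblk S d z t i = vec (d i) (\<lambda>a. z $ pos S d t i a)"

definition mblk ::
  "netsys \<Rightarrow> (nat \<Rightarrow> nat) \<Rightarrow> (nat \<Rightarrow> nat) \<Rightarrow> real mat \<Rightarrow> nat \<Rightarrow> nat \<Rightarrow> nat \<Rightarrow> nat \<Rightarrow> real mat" where
  "mblk S d e A t s i j = mat (d i) (e j) (\<lambda>(a, b). A $$ (pos S d t i a, pos S e s j b))"

definition VI :: "netsys \<Rightarrow> nat \<Rightarrow> nat set" where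
  "VI S i = {j. (j, i) \<in> EI S}"

definition VA :: "netsys \<Rightarrow> nat \<Rightarrow> nat set" where
  "VA S i = {j \<in> subsys S. \<exists>t<hor S. Ablk S t i j \<noteq> 0\<^sub>m (xdim S i) (xdim S j)}"

definition VB :: "netsys \<Rightarrow> nat \<Rightarrow> nat set" where
  "VB S i = {j \<in> subsys S. \<exists>t<hor S. Bblk S t i j \<noteq> 0\<^sub>m (xdim S i) (udim S j)}"

definition Nset :: "netsys \<Rightarrow> nat \<Rightarrow> nat set" where
  "Nset S i = {j \<in> VI S i. VA S j \<subseteq> VI S i \<and> (\<Union>k\<in>VB S j. VI S k) \<subseteq> VI S i}"

definition Cset :: "netsys \<Rightarrow> nat \<Rightarrow> nat set" where
  "Cset S i = VI S i - Nset S i"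

definition Call :: "netsys \<Rightarrow> nat set" where
  "Call S = (\<Union>i\<in>subsys S. Cset S i)"

definition EC :: "netsys \<Rightarrow> (nat \<times> nat) set" where
  "EC S = {(j, i). (j, i) \<in> EI S \<and> j \<in> Cset S i}"

definition VCout :: "netsys \<Rightarrow> nat \<Rightarrow> nat set" where
  "VCout S j = {i. (j, i) \<in> EC S}"

definition C_positions :: "netsys \<Rightarrow> nat list" where
  "C_positions S = [pos S (xdim S) t j a. t \<leftarrow> [0..<hor S + 1],
     j \<leftarrow> sorted_list_of_set (Call S), a \<leftarrow> [0..<xdim S j]]"

definition NxC :: "netsys \<Rightarrow> nat" where
  "NxC S = length (C_positions S)"

definition PiC :: "netsys \<Rightarrow> real mat" where
  "PiC S = mat (NxC S) (Nx S) (\<lambda>(r, c). if c = C_positions S ! r then 1 else 0)"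

definition surrogate_dynamics ::
  "netsys \<Rightarrow> real vec \<Rightarrow> real vec \<Rightarrow> real vec \<Rightarrow> real vec \<Rightarrow> bool" where
  "surrogate_dynamics S u w v x \<longleftrightarrow>
     (let X = vblk S (xdim S) x; W = vblk S (xdim S) w; V = vblk S (xdim S) v; U = vblk S (udim S) u in
       (\<forall>i\<in>subsys S. X 0 i = W 0 i)
     \<and> (\<forall>t<hor S. \<forall>i\<in>subsys S. \<forall>a<xdim S i.
          X (t + 1) i $ a =
              (\<Sum>j\<in>subsys S - Cset S i. (Ablk S t i j *\<^sub>v X t j) $ a)
            + (\<Sum>j\<in>Cset S i. (Ablk S t i j *\<^sub>v V t j) $ a)
            + (\<Sum>j\<in>subsys S. (Bblk S t i j *\<^sub>v U t j) $ a)
            + W (t + 1) i $ a))"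

definition surrogate_state ::
  "netsys \<Rightarrow> real mat \<Rightarrow> real mat \<Rightarrow> real mat \<Rightarrow> real vec \<Rightarrow> real vec \<Rightarrow> real vec \<Rightarrow> real vec" where
  "surrogate_state S Bt Lt Ht u w v = Bt *\<^sub>v u + Lt *\<^sub>v w + Ht *\<^sub>v (PiC S *\<^sub>v v)"

text \<open>
  This determines \<open>Bt\<close>, \<open>Lt\<close>, \<open>Ht\<close> uniquely, and such matrices exist whenever \<open>netsys_ok S\<close>, since
  the dynamics are linear, determine \<open>x\<close>, and depend on \<open>v\<close> only through its components in \<open>Call S\<close>.
\<close>

definition surrogate_matrices :: "netsys \<Rightarrow> real mat \<Rightarrow> real mat \<Rightarrow> real mat \<Rightarrow> bool" where
  "surrogate_matrices S Bt Lt Ht \<longleftrightarrow>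
     Bt \<in> carrier_mat (Nx S) (Nu S) \<and> Lt \<in> carrier_mat (Nx S) (Nx S)
   \<and> Ht \<in> carrier_mat (Nx S) (NxC S)
   \<and> (\<forall>u\<in>carrier_vec (Nu S). \<forall>w\<in>carrier_vec (Nx S). \<forall>v\<in>carrier_vec (Nx S). \<forall>x\<in>carrier_vec (Nx S).
        surrogate_dynamics S u w v x \<longleftrightarrow> x = surrogate_state S Bt Lt Ht u w v)"

definition causal_space :: "netsys \<Rightarrow> (nat \<Rightarrow> nat set) \<Rightarrow> real mat set" where
  "causal_space S nb = {Q \<in> carrier_mat (Nu S) (Nx S).
     \<forall>t<hor S. \<forall>s\<le>hor S. \<forall>i\<in>subsys S. \<forall>j\<in>subsys S. \<not> (s \<le> t \<and> j \<in> nb i) \<longrightarrow>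
       mblk S (udim S) (xdim S) Q t s i j = 0\<^sub>m (udim S i) (xdim S j)}"

definition QN :: "netsys \<Rightarrow> real mat set" where
  "QN S = causal_space S (Nset S)"

definition QC :: "netsys \<Rightarrow> real mat set" where
  "QC S = causal_space S (Cset S)"

definition YC :: "netsys \<Rightarrow> real mat set" where
  "YC S = {Y \<in> carrier_mat (Nx S) (Nx S).
     \<forall>t\<le>hor S. \<forall>s\<le>hor S. \<forall>i\<in>subsys S. \<forall>j\<in>subsys S.
       t \<le> s \<or> \<not> VCout S i \<subseteq> VCout S j \<longrightarrow>
       mblk S (xdim S) (xdim S) Y t s i j = 0\<^sub>m (xdim S i) (xdim S j)}"

definition Zset :: "netsys \<Rightarrow> real mat set" where
  "Zset S = {Z \<in> carrier_mat (Nx S) (Nx S). lower_triangular Z \<and> invertible_mat Z}"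

definition J_feasible ::
  "netsys \<Rightarrow> real mat \<Rightarrow> real mat \<Rightarrow> real mat \<Rightarrow> real vec set \<Rightarrow> real vec set
   \<Rightarrow> real mat \<Rightarrow> real mat \<Rightarrow> real mat \<Rightarrow> real vec \<Rightarrow> real vec \<Rightarrow> bool" where
  "J_feasible S Bt Lt Ht W \<Xi> Qw Q\<xi> Z ubar vbar \<longleftrightarrow>
     Qw \<in> QN S \<and> Q\<xi> \<in> carrier_mat (Nu S) (Nx S) \<and> Z \<in> Zset S
   \<and> ubar \<in> carrier_vec (Nu S) \<and> vbar \<in> carrier_vec (Nx S)
   \<and> Q\<xi> * minv Z \<in> QC S
   \<and> (\<forall>w\<in>W. \<forall>\<xi>\<in>\<Xi>.
        let v = vbar + Z *\<^sub>v \<xi>;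
            u = ubar + Qw *\<^sub>v w + Q\<xi> *\<^sub>v \<xi>;
            x = surrogate_state S Bt Lt Ht u w v
        in PiC S *\<^sub>v x \<in> (\<lambda>y. PiC S *\<^sub>v y) ` {vbar + y | y. y \<in> (\<lambda>z. Z *\<^sub>v z) ` W}
         \<and> Fx S *\<^sub>v x + Fu S *\<^sub>v u + Fw S *\<^sub>v w \<le> gvec S)"

definition J_objective ::
  "netsys \<Rightarrow> real mat \<Rightarrow> real mat \<Rightarrow> real mat \<Rightarrow> 'a measure \<Rightarrow> ('a \<Rightarrow> real vec) \<Rightarrow> ('a \<Rightarrow> real vec)
   \<Rightarrow> real mat \<Rightarrow> real mat \<Rightarrow> real mat \<Rightarrow> real vec \<Rightarrow> real vec \<Rightarrow> real" where
  "J_objective S Bt Lt Ht Pr w \<xi> Qw Q\<xi> Z ubar vbar =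
     (\<integral>\<omega>. (let v = vbar + Z *\<^sub>v \<xi> \<omega>;
               u = ubar + Qw *\<^sub>v w \<omega> + Q\<xi> *\<^sub>v \<xi> \<omega>;
               x = surrogate_state S Bt Lt Ht u (w \<omega>) v
           in x \<bullet> (Rx S *\<^sub>v x) + u \<bullet> (Ru S *\<^sub>v u)) \<partial>Pr)"

definition S_lmi ::
  "netsys \<Rightarrow> real mat \<Rightarrow> real mat \<Rightarrow> real mat \<Rightarrow> real mat \<Rightarrow> real \<Rightarrow> real \<Rightarrow> real mat" where
  "S_lmi S Sig Y Pw P\<xi> lam \<beta> =
     (let P = PiC S; n = Nx S; Sigt = lam \<cdot>\<^sub>m Sig - Y * Sig - Sig * Y\<^sup>T in
      four_block_mat
        (P * Sigt * P\<^sup>T)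
        (append_cols (P * Pw) (P * P\<xi>))
        ((Pw\<^sup>T * P\<^sup>T) @\<^sub>r (P\<xi>\<^sup>T * P\<^sup>T))
        (four_block_mat (\<beta> \<cdot>\<^sub>m minv Sig) (0\<^sub>m n n) (0\<^sub>m n n) ((lam - \<beta>) \<cdot>\<^sub>m minv Sig)))"

definition S_feasible ::
  "netsys \<Rightarrow> real mat \<Rightarrow> real mat \<Rightarrow> real mat \<Rightarrow> real mat
   \<Rightarrow> real mat \<Rightarrow> real mat \<Rightarrow> real mat \<Rightarrow> real vec \<Rightarrow> real mat \<Rightarrow> real mat
   \<Rightarrow> real vec \<Rightarrow> real vec \<Rightarrow> real \<Rightarrow> real \<Rightarrow> bool" where
  "S_feasible S Bt Lt Ht Sig Qw Q\<xi> Y ubar Pw P\<xi> vbar xbar lam \<beta> \<longleftrightarrow>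
     Qw \<in> QN S \<and> Q\<xi> \<in> QC S \<and> Y \<in> YC S \<and> ubar \<in> carrier_vec (Nu S)
   \<and> Pw \<in> carrier_mat (Nx S) (Nx S) \<and> P\<xi> \<in> carrier_mat (Nx S) (Nx S)
   \<and> vbar \<in> carrier_vec (Nx S) \<and> xbar \<in> carrier_vec (Nx S)
   \<and> 0 \<le> lam \<and> 0 \<le> \<beta> \<and> max 1 \<beta> \<le> lam
   \<and> xbar = Bt *\<^sub>v ubar + Ht *\<^sub>v (PiC S *\<^sub>v vbar)
   \<and> Pw = Bt * Qw + Lt
   \<and> P\<xi> = Bt * Q\<xi> + Ht * (PiC S * (lam \<cdot>\<^sub>m 1\<^sub>m (Nx S) - Y))
   \<and> (\<forall>i<ncon S.
        norm2 (psd_sqrt (Nx S) Sig *\<^sub>v ((Fx S * Pw + Fu S * Qw + Fw S)\<^sup>T *\<^sub>v unit_vec (ncon S) i))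
        + norm2 (psd_sqrt (Nx S) Sig *\<^sub>v ((Fx S * P\<xi> + Fu S * Q\<xi>)\<^sup>T *\<^sub>v unit_vec (ncon S) i))
        \<le> unit_vec (ncon S) i \<bullet> (gvec S - Fx S *\<^sub>v xbar - Fu S *\<^sub>v ubar))
   \<and> PiC S *\<^sub>v (xbar - vbar) = 0\<^sub>v (NxC S)
   \<and> psd (NxC S + (Nx S + Nx S)) (S_lmi S Sig Y Pw P\<xi> lam \<beta>)"

definition S_objective ::
  "netsys \<Rightarrow> real mat \<Rightarrow> real mat \<Rightarrow> real mat \<Rightarrow> real vec \<Rightarrow> real mat \<Rightarrow> real mat \<Rightarrow> real vec \<Rightarrow> real" where
  "S_objective S M Qw Q\<xi> ubar Pw P\<xi> xbar =
     tr (P\<xi>\<^sup>T * Rx S * P\<xi> * M + Pw\<^sup>T * Rx S * Pw * M) + xbar \<bullet> (Rx S *\<^sub>v xbar)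
   + tr (Qw\<^sup>T * Ru S * Qw * M + Q\<xi>\<^sup>T * Ru S * Q\<xi> * M) + ubar \<bullet> (Ru S *\<^sub>v ubar)"

end

theory Submission
  imports Defs "Jordan_Normal_Form.Determinant"
begin

text \<open>
  Write \<open>Z = lam I - Y\<close>, \<open>\<Pi>\<close> for the projection onto the coupling components and
  \<open>E\<close> for the ellipsoid with shape matrix \<open>Sig\<close>, which is the support of both
  \<open>w\<close> and \<open>\<xi>\<close>. Substituting the policy into the surrogate dynamics gives
  \<open>x = xbar + Pw w + P\<xi> \<xi>\<close>, where the three coefficients are those fixed by the equality
  constraints of the semidefinite program (\<open>surrogate_affine\<close>). Four things remain.

  For the contract constraint, since \<open>\<Pi> xbar = \<Pi> vbar\<close>, the vector
  \<open>p = \<Pi> (Pw w + P\<xi> \<xi>)\<close> has to lie in \<open>\<Pi> Z E\<close> for all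
  \<open>w, \<xi> \<in> E\<close>. The linear matrix inequality at \<open>(-a, w, \<xi>)\<close> yields
  \<open>2 a \<bullet> p \<le> lam + a \<bullet> \<Pi> (lam Sig - Y Sig - Sig Y\<^sup>T) \<Pi>\<^sup>T a\<close>. The
  matrix in parentheses is at most \<open>Z Sig Z\<^sup>T / lam\<close>, so scaling \<open>a\<close> gives
  \<open>(a \<bullet> p)\<^sup>2 \<le> a \<bullet> K a\<close> with
  \<open>K = \<Pi> Z Sig Z\<^sup>T \<Pi>\<^sup>T\<close>. Since \<open>\<Pi>\<close> has orthonormal rows and
  \<open>Z\<close> is invertible, \<open>K\<close> is positive definite, and
  \<open>Sig Z\<^sup>T \<Pi>\<^sup>T K\<^sup>-\<^sup>1 p\<close> is a point of \<open>E\<close> that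
  \<open>\<Pi> Z\<close> maps to \<open>p\<close> (\<open>shape_form_le\<close>,
  \<open>linear_image_ellipsoid_member\<close>, \<open>projected_contract_member\<close>).

  For the information structure, \<open>Y\<close> is strictly lower triangular, so \<open>Z\<close> is lower
  triangular with diagonal \<open>lam \<ge> 1\<close>. The sparsity of \<open>Y\<close> is made so that the policies
  which are causal in the coupling components are stable under right multiplication by \<open>Y\<close>, and therefore
  by \<open>Z\<^sup>-\<^sup>1\<close> (\<open>QC_mult_contract_inverse\<close>).

  The operational constraints hold because the maximum of a linear form \<open>y\<close> over \<open>E\<close> is
  \<open>|Sig\<^sup>1\<^sup>/\<^sup>2 y|\<close>. As \<open>w\<close> and \<open>\<xi>\<close> range over
  \<open>E\<close> independently, the norm constraints bound each row in the worst case. The square root is specified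
  by its defining properties, so it has to be shown to exist and to be unique (\<open>psd_sqrt_correct\<close>); it is
  constructed as the limit of a contracting iteration.

  The objective values agree because a random vector lies almost surely in its support
  (\<open>AE_vec_support\<close>), so \<open>w\<close> and \<open>\<xi>\<close> are bounded and all their moments
  exist. The two vectors have mean zero, the same second moments, and are independent, so only the constant term and
  the two trace terms of the quadratic cost survive (\<open>has_bochner_integral_affine_quadratic\<close>).
\<close>

section \<open>Positive definite forms and Cauchy-Schwarz inequalities\<close>

text \<open>
  The source of every Cauchy-Schwarz type bound below: a quadratic that never becomes negative
  has no positive discriminant.
\<close>

lemma nonneg_quadratic_discriminant:
  fixes a b c :: real
  assumes nonneg: "\<And>t. 0 \<le> a + 2 * t * b + t\<^sup>2 * c" and c: "0 \<le> c"
  shows "b\<^sup>2 \<le> a * c"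
proof (cases "c = 0")
  case True
  have "b = 0"
  proof (rule ccontr)
    assume "b \<noteq> 0"
    then show False using nonneg[of "- (a + 1) / (2 * b)"] True by (simp add: field_simps)
  qed
  then show ?thesis using True by simp
next
  case False
  then have "0 < c" using c by simp
  have "0 \<le> a + 2 * (- b / c) * b + (- b / c)\<^sup>2 * c" by (rule nonneg)
  also have "\<dots> = (a * c - b\<^sup>2) / c"
    using \<open>0 < c\<close> by (simp add: field_simps power2_eq_square)
  finally show ?thesis using \<open>0 < c\<close> by (simp add: zero_le_divide_iff)
qed

lemma scalar_prod_transpose:
  fixes A :: "real mat"
  assumes "A \<in> carrier_mat nr nc" "x \<in> carrier_vec nr" "y \<in> carrier_vec nc"
  shows "x \<bullet> (A *\<^sub>v y) = y \<bullet> (A\<^sup>T *\<^sub>v x)"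
proof -
  have "(A\<^sup>T *\<^sub>v x) \<bullet> y = x \<bullet> (A *\<^sub>v y)" by (rule transpose_vec_mult_scalar) fact+
  moreover have "(A\<^sup>T *\<^sub>v x) \<bullet> y = y \<bullet> (A\<^sup>T *\<^sub>v x)"
    using assms by (intro comm_scalar_prod[of _ nc]) auto
  ultimately show ?thesis by simp
qed

lemma psd_cauchy_schwarz:
  assumes A: "psd n A" and x: "x \<in> carrier_vec n" and y: "y \<in> carrier_vec n"
  shows "(x \<bullet> (A *\<^sub>v y))\<^sup>2 \<le> (x \<bullet> (A *\<^sub>v x)) * (y \<bullet> (A *\<^sub>v y))"
proof (rule nonneg_quadratic_discriminant)
  have Ac: "A \<in> carrier_mat n n" and sym: "A\<^sup>T = A" using A by (auto simp: psd_def)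
  have yx: "y \<bullet> (A *\<^sub>v x) = x \<bullet> (A *\<^sub>v y)"
    using scalar_prod_transpose[OF Ac y x] sym by simp
  show "0 \<le> y \<bullet> (A *\<^sub>v y)" using A y by (auto simp: psd_def)
  fix t :: real
  have "0 \<le> (x + t \<cdot>\<^sub>v y) \<bullet> (A *\<^sub>v (x + t \<cdot>\<^sub>v y))" using A x y by (auto simp: psd_def)
  also have "A *\<^sub>v (x + t \<cdot>\<^sub>v y) = A *\<^sub>v x + t \<cdot>\<^sub>v (A *\<^sub>v y)"
    using Ac x y by (simp add: mult_add_distrib_mat_vec[of _ n n] mult_mat_vec[of _ n n])
  also have "(x + t \<cdot>\<^sub>v y) \<bullet> (A *\<^sub>v x + t \<cdot>\<^sub>v (A *\<^sub>v y))
      = x \<bullet> (A *\<^sub>v x) + 2 * t * (x \<bullet> (A *\<^sub>v y)) + t\<^sup>2 * (y \<bullet> (A *\<^sub>v y))"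
    using Ac x y
    by (simp add: add_scalar_prod_distrib[of _ n] scalar_prod_add_distrib[of _ n] yx
        power2_eq_square algebra_simps)
  finally show "0 \<le> \<dots>" .
qed

lemma pos_def_imp_psd: "pos_def n A \<Longrightarrow> psd n A"
  unfolding pos_def_def psd_def
  by (metis less_eq_real_def mult_mat_vec_carrier scalar_prod_left_zero)

lemma real_scalar_prod_ge_0: "0 \<le> (x :: real vec) \<bullet> x"
  by (simp add: scalar_prod_def sum_nonneg)

lemma real_scalar_prod_eq_0:
  fixes x :: "real vec"
  assumes "x \<in> carrier_vec n"
  shows "x \<bullet> x = 0 \<longleftrightarrow> x = 0\<^sub>v n"
proof
  assume "x \<bullet> x = 0"
  then have "\<forall>i\<in>{0..<n}. x $ i * x $ i = 0"
    using assms by (subst (asm) scalar_prod_def) (simp add: sum_nonneg_eq_0_iff)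
  then show "x = 0\<^sub>v n" using assms by (intro eq_vecI) auto
qed (use assms in auto)

lemma psd_one: "psd n (1\<^sub>m n)"
  by (auto simp: psd_def real_scalar_prod_ge_0)

text \<open>
  Cauchy-Schwarz between \<open>A x\<close> and \<open>x\<close> bounds \<open>|A x|\<^sup>4\<close> by a multiple of \<open>x \<bullet> A x\<close>.
\<close>

lemma psd_form_zero:
  assumes A: "psd n A" and x: "x \<in> carrier_vec n" and "x \<bullet> (A *\<^sub>v x) = 0"
  shows "A *\<^sub>v x = 0\<^sub>v n"
proof -
  have Ac: "A \<in> carrier_mat n n" using A by (simp add: psd_def)
  have "((A *\<^sub>v x) \<bullet> (A *\<^sub>v x))\<^sup>2
      \<le> ((A *\<^sub>v x) \<bullet> (A *\<^sub>v (A *\<^sub>v x))) * (x \<bullet> (A *\<^sub>v x))"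
    using Ac x by (intro psd_cauchy_schwarz[OF A]) auto
  then have "(A *\<^sub>v x) \<bullet> (A *\<^sub>v x) = 0" using assms(3) by simp
  then show ?thesis using real_scalar_prod_eq_0[of "A *\<^sub>v x" n] Ac x by auto
qed

lemma minv_inverse:
  assumes A: "A \<in> carrier_mat n n" and det: "det A \<noteq> 0"
  shows "minv A \<in> carrier_mat n n" "A * minv A = 1\<^sub>m n" "minv A * A = 1\<^sub>m n"
proof -
  have "A \<in> Units (ring_mat TYPE(real) n ())" by (rule det_non_zero_imp_unit[OF A det])
  then obtain B where "mat_inverse A = Some B" using mat_inverse(1)[OF A, where b="()"] by (cases "mat_inverse A") auto
  then show "minv A \<in> carrier_mat n n" "A * minv A = 1\<^sub>m n" "minv A * A = 1\<^sub>m n"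
    using mat_inverse(2)[OF A, of B] by (auto simp: minv_def)
qed

lemma pos_def_det_nonzero:
  assumes A: "pos_def n A"
  shows "det A \<noteq> 0"
proof
  have Ac: "A \<in> carrier_mat n n" using A by (simp add: pos_def_def)
  assume "det A = 0"
  then obtain v where v: "v \<in> carrier_vec n" "v \<noteq> 0\<^sub>v n" "A *\<^sub>v v = 0\<^sub>v n"
    using det_0_iff_vec_prod_zero[OF Ac] by auto
  then have "0 < v \<bullet> (A *\<^sub>v v)" using A by (auto simp: pos_def_def)
  then show False using v by simp
qed

lemma pos_def_minv:
  assumes A: "pos_def n A"
  shows "minv A \<in> carrier_mat n n" "A * minv A = 1\<^sub>m n" "minv A * A = 1\<^sub>m n"
    and "\<And>x. x \<in> carrier_vec n \<Longrightarrow> A *\<^sub>v (minv A *\<^sub>v x) = x"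
    and "\<And>x. x \<in> carrier_vec n \<Longrightarrow> minv A *\<^sub>v (A *\<^sub>v x) = x"
proof -
  have Ac: "A \<in> carrier_mat n n" using A by (simp add: pos_def_def)
  note inv = minv_inverse[OF Ac pos_def_det_nonzero[OF A]]
  show "minv A \<in> carrier_mat n n" "A * minv A = 1\<^sub>m n" "minv A * A = 1\<^sub>m n" by (fact inv)+
  show "A *\<^sub>v (minv A *\<^sub>v x) = x" "minv A *\<^sub>v (A *\<^sub>v x) = x" if x: "x \<in> carrier_vec n" for x
    using assoc_mult_mat_vec[OF Ac inv(1) x] assoc_mult_mat_vec[OF inv(1) Ac x] inv x by auto
qed

text \<open>
  Cauchy-Schwarz for \<open>A\<close> between \<open>y\<close> and \<open>A\<^sup>-\<^sup>1 z\<close>. It says that the ellipsoid with shape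
  matrix \<open>A\<close> lies between the hyperplanes on which \<open>y\<close> takes the values \<open>\<plusminus> sqrt (y \<bullet> A y)\<close>.
\<close>

lemma pos_def_dual_cauchy_schwarz:
  assumes A: "pos_def n A" and y: "y \<in> carrier_vec n" and z: "z \<in> carrier_vec n"
  shows "(y \<bullet> z)\<^sup>2 \<le> (y \<bullet> (A *\<^sub>v y)) * (z \<bullet> (minv A *\<^sub>v z))"
proof -
  note inv = pos_def_minv[OF A]
  have Mz: "minv A *\<^sub>v z \<in> carrier_vec n" using inv(1) z by auto
  have "(minv A *\<^sub>v z) \<bullet> z = z \<bullet> (minv A *\<^sub>v z)" by (rule comm_scalar_prod[OF Mz z])
  then show ?thesis
    using psd_cauchy_schwarz[OF pos_def_imp_psd[OF A] y Mz] inv(4)[OF z] by simp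
qed

section \<open>Norms of vectors and matrices\<close>

lemma norm2_sqrt_apply:
  assumes "psd n R" "R * R = A" "y \<in> carrier_vec n"
  shows "norm2 (R *\<^sub>v y) = sqrt (y \<bullet> (A *\<^sub>v y))"
proof -
  have Rc: "R \<in> carrier_mat n n" and sym: "R\<^sup>T = R" using assms by (auto simp: psd_def)
  have "(R *\<^sub>v y) \<bullet> (R *\<^sub>v y) = y \<bullet> (R\<^sup>T *\<^sub>v (R *\<^sub>v y))"
    using Rc assms(3) scalar_prod_transpose[of R n n "R *\<^sub>v y" y] by simp
  also have "\<dots> = y \<bullet> (A *\<^sub>v y)"
    using Rc assms assoc_mult_mat_vec[OF Rc Rc assms(3)] sym by simp
  finally show ?thesis by (simp add: norm2_def)
qed

lemma smult_mat_assoc: "a \<cdot>\<^sub>m (b \<cdot>\<^sub>m M) = (a * b) \<cdot>\<^sub>m (M :: real mat)"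
  by (rule eq_matI) auto

definition op_bound :: "nat \<Rightarrow> real \<Rightarrow> real mat \<Rightarrow> bool" where
  "op_bound n r X \<longleftrightarrow> (\<forall>x\<in>carrier_vec n. norm2 (X *\<^sub>v x) \<le> r * norm2 x)"

lemma norm2_L2_set: "norm2 x = L2_set (\<lambda>i. x $ i) {0..<dim_vec x}"
  by (simp add: norm2_def scalar_prod_def L2_set_def power2_eq_square)

lemma norm2_ge_0: "0 \<le> norm2 x"
  by (simp add: norm2_def real_scalar_prod_ge_0)

lemma norm2_square: "norm2 x * norm2 x = x \<bullet> x"
  by (simp add: norm2_def real_scalar_prod_ge_0)

lemma norm2_triangle:
  assumes "x \<in> carrier_vec n" "y \<in> carrier_vec n"
  shows "norm2 (x + y) \<le> norm2 x + norm2 y"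
proof -
  have "norm2 (x + y) = L2_set (\<lambda>i. x $ i + y $ i) {0..<n}"
    using assms unfolding norm2_L2_set by (intro L2_set_cong) auto
  also have "\<dots> \<le> norm2 x + norm2 y"
    using assms L2_set_triangle_ineq[of "\<lambda>i. x $ i" "\<lambda>i. y $ i" "{0..<n}"]
    by (simp add: norm2_L2_set)
  finally show ?thesis .
qed

lemma norm2_smult: "norm2 (c \<cdot>\<^sub>v x) = \<bar>c\<bar> * norm2 x"
proof -
  have "(c \<cdot>\<^sub>v x) \<bullet> (c \<cdot>\<^sub>v x) = c\<^sup>2 * (x \<bullet> x)"
    by (simp add: power2_eq_square)
  then show ?thesis by (simp add: norm2_def real_sqrt_mult)
qed

lemma norm2_zero: "norm2 (0\<^sub>v n) = 0"
  by (simp add: norm2_def)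

lemma abs_index_le_norm2:
  assumes "i < dim_vec x"
  shows "\<bar>x $ i\<bar> \<le> norm2 x"
proof -
  have "x $ i * x $ i \<le> x \<bullet> x"
    unfolding scalar_prod_def using assms by (intro member_le_sum) auto
  then have "sqrt (x $ i * x $ i) \<le> norm2 x"
    unfolding norm2_def by (rule real_sqrt_le_mono)
  then show ?thesis by simp
qed

lemma scalar_prod_le_norm2:
  assumes "x \<in> carrier_vec n" "y \<in> carrier_vec n"
  shows "x \<bullet> y \<le> norm2 x * norm2 y"
proof -
  have "(x \<bullet> y)\<^sup>2 \<le> (norm2 x * norm2 y)\<^sup>2"
    using psd_cauchy_schwarz[OF psd_one assms] assms
    by (simp add: power2_eq_square norm2_square algebra_simps)
      (metis mult.assoc mult.left_commute norm2_square)
  then show ?thesis using norm2_ge_0 by (meson mult_nonneg_nonneg power2_le_imp_le)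
qed

lemma op_bound_entry:
  assumes X: "X \<in> carrier_mat n n" and b: "op_bound n r X" and ij: "i < n" "j < n"
  shows "\<bar>X $$ (i, j)\<bar> \<le> r"
proof -
  have "\<bar>X $$ (i, j)\<bar> = \<bar>(X *\<^sub>v unit_vec n j) $ i\<bar>"
    using X ij by simp
  also have "\<dots> \<le> norm2 (X *\<^sub>v unit_vec n j)"
    using X ij by (intro abs_index_le_norm2) auto
  also have "\<dots> \<le> r * norm2 (unit_vec n j :: real vec)"
    using b by (auto simp: op_bound_def)
  also have "norm2 (unit_vec n j :: real vec) = 1"
    using ij by (simp add: norm2_def)
  finally show ?thesis by simp
qed

text \<open>
  For a positive semidefinite matrix a bound on the quadratic form is already a bound on the
  operator norm, by Cauchy-Schwarz for the form between \<open>A x\<close> and \<open>x\<close>.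
\<close>

lemma psd_op_bound:
  assumes A: "psd n A" and q: "0 \<le> q"
    and le: "\<And>x. x \<in> carrier_vec n \<Longrightarrow> x \<bullet> (A *\<^sub>v x) \<le> q * (x \<bullet> x)"
  shows "op_bound n q A"
  unfolding op_bound_def
proof
  fix x :: "real vec" assume x: "x \<in> carrier_vec n"
  have Ac: "A \<in> carrier_mat n n" using A by (simp add: psd_def)
  define y where "y = A *\<^sub>v x"
  have y: "y \<in> carrier_vec n" using Ac x by (auto simp: y_def)
  have "(y \<bullet> y) * (y \<bullet> y) \<le> (y \<bullet> (A *\<^sub>v y)) * (x \<bullet> (A *\<^sub>v x))"
    using psd_cauchy_schwarz[OF A y x] by (simp add: y_def power2_eq_square)
  also have "\<dots> \<le> (q * (y \<bullet> y)) * (q * (x \<bullet> x))"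
    using A x y le q by (intro mult_mono) (auto simp: psd_def real_scalar_prod_ge_0)
  finally have "(y \<bullet> y) * (y \<bullet> y) \<le> (y \<bullet> y) * (q\<^sup>2 * (x \<bullet> x))"
    by (simp add: power2_eq_square algebra_simps)
  then have "y \<bullet> y \<le> q\<^sup>2 * (x \<bullet> x)"
    using q real_scalar_prod_ge_0[of x] real_scalar_prod_ge_0[of y]
    by (cases "y \<bullet> y = 0") auto
  then have "sqrt (y \<bullet> y) \<le> sqrt (q\<^sup>2 * (x \<bullet> x))" by (rule real_sqrt_le_mono)
  then show "norm2 (A *\<^sub>v x) \<le> q * norm2 x"
    using q by (simp add: norm2_def y_def real_sqrt_mult)
qed

section \<open>The square root of a positive definite matrix\<close>

text \<open>
  A fixed point \<open>Y = (B + Y\<^sup>2) / 2\<close> satisfies \<open>(1 - Y)\<^sup>2 = 1 - B\<close>, so a square root of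
  \<open>1 - B\<close> is found by iterating this equation from \<open>0\<close>.
\<close>

primrec sqrt_iter :: "nat \<Rightarrow> real mat \<Rightarrow> nat \<Rightarrow> real mat" where
  "sqrt_iter n B 0 = 0\<^sub>m n n"
| "sqrt_iter n B (Suc k) = (1/2) \<cdot>\<^sub>m (B + sqrt_iter n B k * sqrt_iter n B k)"

lemma sqrt_iter_carrier:
  "B \<in> carrier_mat n n \<Longrightarrow> sqrt_iter n B k \<in> carrier_mat n n"
  by (induction k) auto

lemma sqrt_iter_sym:
  assumes B: "B \<in> carrier_mat n n" and sym: "B\<^sup>T = B"
  shows "(sqrt_iter n B k)\<^sup>T = sqrt_iter n B k"
proof (induction k)
  case (Suc k)
  let ?Y = "sqrt_iter n B k"
  have Y: "?Y \<in> carrier_mat n n" by (rule sqrt_iter_carrier[OF B])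
  have "((1/2) \<cdot>\<^sub>m (B + ?Y * ?Y))\<^sup>T = (1/2) \<cdot>\<^sub>m (B + ?Y * ?Y)\<^sup>T" by (rule eq_matI) (use B Y in auto)
  also have "(B + ?Y * ?Y)\<^sup>T = B\<^sup>T + ?Y\<^sup>T * ?Y\<^sup>T"
    using B Y by (simp add: transpose_add[of _ n n] transpose_mult[of _ n n])
  finally show ?case using Suc sym by simp
qed (auto intro!: eq_matI)

lemma sqrt_iter_apply:
  assumes B: "B \<in> carrier_mat n n" and x: "x \<in> carrier_vec n"
  shows "sqrt_iter n B (Suc k) *\<^sub>v x
    = (1/2) \<cdot>\<^sub>v (B *\<^sub>v x + sqrt_iter n B k *\<^sub>v (sqrt_iter n B k *\<^sub>v x))"
proof -
  let ?Y = "sqrt_iter n B k"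
  have Y: "?Y \<in> carrier_mat n n" by (rule sqrt_iter_carrier[OF B])
  have "sqrt_iter n B (Suc k) *\<^sub>v x = (1/2) \<cdot>\<^sub>v ((B + ?Y * ?Y) *\<^sub>v x)"
    by (rule eq_vecI) (use B Y x in auto)
  also have "(B + ?Y * ?Y) *\<^sub>v x = B *\<^sub>v x + ?Y *\<^sub>v (?Y *\<^sub>v x)"
    using B Y x by (simp add: add_mult_distrib_mat_vec[of _ n n] assoc_mult_mat_vec[of _ n n _ n])
  finally show ?thesis .
qed

text \<open>
  The condition on \<open>r\<close> says that the scalar map \<open>y \<mapsto> (q + y\<^sup>2) / 2\<close> does not exceed \<open>r\<close>
  between \<open>0\<close> and \<open>r\<close>; the operator norms of the iterates follow that scalar iteration.
\<close>

lemma sqrt_iter_bound: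
  assumes B: "B \<in> carrier_mat n n" and q: "op_bound n q B"
    and r: "0 \<le> r" "q + r\<^sup>2 \<le> 2 * r"
  shows "op_bound n r (sqrt_iter n B k)"
proof (induction k)
  case 0
  have "0\<^sub>m n n *\<^sub>v x = 0\<^sub>v n" if "x \<in> carrier_vec n" for x :: "real vec"
    using that by (intro eq_vecI) auto
  then show ?case using r norm2_ge_0 by (simp add: op_bound_def norm2_zero)
next
  case (Suc k)
  let ?Y = "sqrt_iter n B k"
  have Y: "?Y \<in> carrier_mat n n" by (rule sqrt_iter_carrier[OF B])
  show ?case unfolding op_bound_def
  proof
    fix x :: "real vec" assume x: "x \<in> carrier_vec n"
    have Yx: "?Y *\<^sub>v x \<in> carrier_vec n" using Y x by auto
    have "norm2 (sqrt_iter n B (Suc k) *\<^sub>v x)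
        = norm2 (B *\<^sub>v x + ?Y *\<^sub>v (?Y *\<^sub>v x)) / 2"
      unfolding sqrt_iter_apply[OF B x] norm2_smult by simp
    also have "\<dots> \<le> (norm2 (B *\<^sub>v x) + norm2 (?Y *\<^sub>v (?Y *\<^sub>v x))) / 2"
      using B Y x by (intro divide_right_mono norm2_triangle[of _ n]) auto
    also have "\<dots> \<le> (q * norm2 x + r * (r * norm2 x)) / 2"
    proof -
      have "norm2 (?Y *\<^sub>v (?Y *\<^sub>v x)) \<le> r * norm2 (?Y *\<^sub>v x)"
        using Suc Yx by (auto simp: op_bound_def)
      also have "\<dots> \<le> r * (r * norm2 x)"
        using Suc x r by (intro mult_left_mono) (auto simp: op_bound_def)
      finally show ?thesis using q x by (auto simp: op_bound_def)
    qed
    also have "\<dots> = (q + r\<^sup>2) * norm2 x / 2" by (simp add: power2_eq_square algebra_simps)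
    also have "\<dots> \<le> 2 * r * norm2 x / 2"
      using r norm2_ge_0 by (intro divide_right_mono mult_right_mono) auto
    finally show "norm2 (sqrt_iter n B (Suc k) *\<^sub>v x) \<le> r * norm2 x" by simp
  qed
qed

text \<open>
  With \<open>Y\<close>, \<open>Y'\<close> consecutive iterates and \<open>D = Y' - Y\<close>, the next difference is
  \<open>(Y' D + D Y) / 2\<close>. The matrices need not commute, but both factors have norm at most \<open>r\<close>, so
  the differences decay geometrically when \<open>r < 1\<close>.
\<close>

lemma sqrt_iter_step_bound:
  assumes B: "B \<in> carrier_mat n n" and q: "op_bound n q B"
    and r: "0 \<le> r" "q + r\<^sup>2 \<le> 2 * r"
  shows "op_bound n (r ^ Suc k) (sqrt_iter n B (Suc k) - sqrt_iter n B k)"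
proof (induction k)
  case 0
  have "sqrt_iter n B (Suc 0) - sqrt_iter n B 0 = sqrt_iter n B (Suc 0)"
    using sqrt_iter_carrier[OF B, of "Suc 0"] by auto
  then show ?case using sqrt_iter_bound[OF assms, of "Suc 0"] by simp
next
  case (Suc k)
  let ?Y = "sqrt_iter n B k" and ?Y' = "sqrt_iter n B (Suc k)" and ?Y'' = "sqrt_iter n B (Suc (Suc k))"
  note c = sqrt_iter_carrier[OF B]
  have Y: "?Y \<in> carrier_mat n n" "?Y' \<in> carrier_mat n n" "?Y'' \<in> carrier_mat n n"
    by (rule c)+
  show ?case unfolding op_bound_def
  proof
    fix x :: "real vec" assume x: "x \<in> carrier_vec n"
    let ?D = "?Y' - ?Y"
    have D: "?D \<in> carrier_mat n n" using Y by auto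
    have Dx: "?D *\<^sub>v x \<in> carrier_vec n" and Yx: "?Y *\<^sub>v x \<in> carrier_vec n"
      and Y'x: "?Y' *\<^sub>v x \<in> carrier_vec n" and Bx: "B *\<^sub>v x \<in> carrier_vec n"
      using D Y B x by (auto intro!: mult_mat_vec_carrier simp del: sqrt_iter.simps)
    have "(?Y'' - ?Y') *\<^sub>v x = ?Y'' *\<^sub>v x - ?Y' *\<^sub>v x"
      by (rule minus_mult_distrib_mat_vec) (use Y x in auto)
    also have "\<dots> = (1/2) \<cdot>\<^sub>v (B *\<^sub>v x + ?Y' *\<^sub>v (?Y' *\<^sub>v x)) - (1/2) \<cdot>\<^sub>v (B *\<^sub>v x + ?Y *\<^sub>v (?Y *\<^sub>v x))"
      by (simp only: sqrt_iter_apply[OF B x])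
    also have "\<dots> = (1/2) \<cdot>\<^sub>v ((?Y' *\<^sub>v (?Y' *\<^sub>v x) - ?Y' *\<^sub>v (?Y *\<^sub>v x)) + (?Y' *\<^sub>v (?Y *\<^sub>v x) - ?Y *\<^sub>v (?Y *\<^sub>v x)))"
      using Y Bx by (intro eq_vecI) (auto simp del: sqrt_iter.simps simp: carrier_matD[OF Y(1)] carrier_matD[OF Y(2)] carrier_matD[OF B] index_mult_mat_vec algebra_simps)
    also have "?Y' *\<^sub>v (?Y' *\<^sub>v x) - ?Y' *\<^sub>v (?Y *\<^sub>v x) = ?Y' *\<^sub>v (?D *\<^sub>v x)"
      using minus_mult_distrib_mat_vec[OF Y(2) Y(1) x] mult_minus_distrib_mat_vec[OF Y(2) Y'x Yx] by simp
    also have "?Y' *\<^sub>v (?Y *\<^sub>v x) - ?Y *\<^sub>v (?Y *\<^sub>v x) = ?D *\<^sub>v (?Y *\<^sub>v x)"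
      using minus_mult_distrib_mat_vec[OF Y(2) Y(1) Yx] by simp
    finally have eq: "(?Y'' - ?Y') *\<^sub>v x = (1/2) \<cdot>\<^sub>v (?Y' *\<^sub>v (?D *\<^sub>v x) + ?D *\<^sub>v (?Y *\<^sub>v x))" .
    have "norm2 ((?Y'' - ?Y') *\<^sub>v x) \<le> (norm2 (?Y' *\<^sub>v (?D *\<^sub>v x)) + norm2 (?D *\<^sub>v (?Y *\<^sub>v x))) / 2"
      unfolding eq norm2_smult
      using norm2_triangle[of "?Y' *\<^sub>v (?D *\<^sub>v x)" n "?D *\<^sub>v (?Y *\<^sub>v x)"] Y D Dx Yx
      by (simp del: sqrt_iter.simps)
    also have "norm2 (?Y' *\<^sub>v (?D *\<^sub>v x)) \<le> r * norm2 (?D *\<^sub>v x)"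
      using sqrt_iter_bound[OF assms, of "Suc k"] Dx unfolding op_bound_def by blast
    also have "r * norm2 (?D *\<^sub>v x) \<le> r * (r ^ Suc k * norm2 x)"
      using Suc x r(1) unfolding op_bound_def by (intro mult_left_mono) auto
    also have "norm2 (?D *\<^sub>v (?Y *\<^sub>v x)) \<le> r ^ Suc k * norm2 (?Y *\<^sub>v x)"
      using Suc Yx unfolding op_bound_def by blast
    also have "r ^ Suc k * norm2 (?Y *\<^sub>v x) \<le> r ^ Suc k * (r * norm2 x)"
      using sqrt_iter_bound[OF assms, of k] x r(1) unfolding op_bound_def by (intro mult_left_mono) auto
    finally show "norm2 ((?Y'' - ?Y') *\<^sub>v x) \<le> r ^ Suc (Suc k) * norm2 x"
      by (simp add: algebra_simps)
  qed
qed

lemma sqrt_iter_converges: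
  assumes B: "B \<in> carrier_mat n n" and q: "op_bound n q B"
    and r: "0 \<le> r" "r < 1" "q + r\<^sup>2 \<le> 2 * r" and ij: "i < n" "j < n"
  shows "convergent (\<lambda>k. sqrt_iter n B k $$ (i, j))"
proof -
  let ?y = "\<lambda>k. sqrt_iter n B k $$ (i, j)"
  have "summable (\<lambda>k. ?y (Suc k) - ?y k)"
  proof (rule summable_comparison_test')
    show "summable (\<lambda>k. r ^ Suc k)" using r by (simp add: summable_geometric summable_mult)
    show "norm (?y (Suc k) - ?y k) \<le> r ^ Suc k" if "0 \<le> k" for k
    proof -
      have "sqrt_iter n B (Suc k) - sqrt_iter n B k \<in> carrier_mat n n"
        by (rule minus_carrier_mat[OF sqrt_iter_carrier[OF B]])
      then show ?thesis
        using op_bound_entry[OF _ sqrt_iter_step_bound[OF B q r(1,3), of k] ij]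
          sqrt_iter_carrier[OF B, of k] ij
        by (simp del: sqrt_iter.simps)
    qed
  qed
  then have "convergent (\<lambda>m. \<Sum>k<m. ?y (Suc k) - ?y k)"
    by (simp add: summable_iff_convergent)
  moreover have "(\<lambda>m. \<Sum>k<m. ?y (Suc k) - ?y k) = ?y"
    by (rule ext, subst sum_lessThan_telescope) (use ij in simp)
  ultimately show ?thesis by simp
qed

lemma quad_form_sum:
  fixes A :: "real mat"
  assumes "A \<in> carrier_mat nr nc" "x \<in> carrier_vec nr" "y \<in> carrier_vec nc"
  shows "x \<bullet> (A *\<^sub>v y) = (\<Sum>i<nr. \<Sum>j<nc. A $$ (i, j) * (x $ i * y $ j))"
  using assms
  by (auto simp: scalar_prod_def sum_distrib_left atLeast0LessThan algebra_simps intro!: sum.cong)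

lemma quad_form_le:
  fixes A :: "real mat"
  assumes A: "A \<in> carrier_mat n n" and x: "x \<in> carrier_vec n"
  shows "x \<bullet> (A *\<^sub>v x) \<le> (\<Sum>i<n. \<Sum>j<n. \<bar>A $$ (i, j)\<bar>) * (x \<bullet> x)"
proof -
  have "A $$ (i, j) * (x $ i * x $ j) \<le> \<bar>A $$ (i, j)\<bar> * (x \<bullet> x)" if "i < n" "j < n" for i j
  proof -
    have "A $$ (i, j) * (x $ i * x $ j) \<le> \<bar>A $$ (i, j)\<bar> * (\<bar>x $ i\<bar> * \<bar>x $ j\<bar>)"
      by (metis abs_ge_self abs_mult)
    also have "\<dots> \<le> \<bar>A $$ (i, j)\<bar> * (norm2 x * norm2 x)"
      using that x by (intro mult_left_mono mult_mono abs_index_le_norm2 norm2_ge_0) auto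
    finally show ?thesis by (simp add: norm2_square)
  qed
  then show ?thesis
    unfolding quad_form_sum[OF A x x] sum_distrib_right by (intro sum_mono) auto
qed

text \<open>
  A bound on the form of \<open>A\<^sup>-\<^sup>1\<close> from above turns, by the dual Cauchy-Schwarz inequality with both
  vectors equal to \<open>x\<close>, into a bound on the form of \<open>A\<close> from below.
\<close>

lemma pos_def_coercive:
  assumes A: "pos_def n A"
  obtains d where "0 < d" "\<And>x. x \<in> carrier_vec n \<Longrightarrow> d * (x \<bullet> x) \<le> x \<bullet> (A *\<^sub>v x)"
proof -
  define K where "K = (\<Sum>i<n. \<Sum>j<n. \<bar>minv A $$ (i, j)\<bar>) + 1"
  have K: "0 < K" by (auto simp: K_def intro!: add_nonneg_pos sum_nonneg)
  have "(1 / K) * (x \<bullet> x) \<le> x \<bullet> (A *\<^sub>v x)" if x: "x \<in> carrier_vec n" for x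
  proof -
    have Ax: "0 \<le> x \<bullet> (A *\<^sub>v x)" using pos_def_imp_psd[OF A] x by (auto simp: psd_def)
    have "x \<bullet> (minv A *\<^sub>v x) \<le> K * (x \<bullet> x)"
      using quad_form_le[OF pos_def_minv(1)[OF A] x] real_scalar_prod_ge_0[of x]
      by (simp add: K_def algebra_simps)
    then have "(x \<bullet> x)\<^sup>2 \<le> (x \<bullet> (A *\<^sub>v x)) * (K * (x \<bullet> x))"
      using pos_def_dual_cauchy_schwarz[OF A x x] Ax by (meson mult_left_mono order_trans)
    then have "(x \<bullet> x) * (x \<bullet> x) \<le> (x \<bullet> x) * (K * (x \<bullet> (A *\<^sub>v x)))"
      by (simp add: power2_eq_square algebra_simps)
    then have "x \<bullet> x \<le> K * (x \<bullet> (A *\<^sub>v x))"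
      using real_scalar_prod_ge_0[of x] K Ax by (cases "x \<bullet> x = 0") auto
    then show ?thesis using K by (simp add: field_simps)
  qed
  then show thesis using that[of "1 / K"] K by simp
qed

lemma psd_sqrt_of_contraction:
  assumes B: "B \<in> carrier_mat n n" and sym: "B\<^sup>T = B" and q: "op_bound n q B" "0 \<le> q" "q < 1"
  obtains R where "psd n R" "R * R = 1\<^sub>m n - B"
proof -
  \<comment> \<open>the smaller root of \<open>q + r\<^sup>2 = 2 * r\<close>\<close>
  define r where "r = 1 - sqrt (1 - q)"
  have r: "0 \<le> r" "r < 1" "q + r\<^sup>2 \<le> 2 * r"
    using q by (auto simp: r_def power2_eq_square algebra_simps)
  let ?y = "sqrt_iter n B"
  note yc = sqrt_iter_carrier[OF B]
  define Y where "Y = mat n n (\<lambda>(i, j). lim (\<lambda>k. ?y k $$ (i, j)))"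
  have Y: "Y \<in> carrier_mat n n" by (simp add: Y_def)
  have lim: "(\<lambda>k. ?y k $$ (i, j)) \<longlonglongrightarrow> Y $$ (i, j)" if "i < n" "j < n" for i j
    using sqrt_iter_converges[OF B q(1) r that] that by (simp add: Y_def convergent_LIMSEQ_iff)
  have Ysym: "Y\<^sup>T = Y"
  proof (rule eq_matI)
    fix i j assume "i < dim_row Y" "j < dim_col Y"
    then have ij: "i < n" "j < n" using Y by auto
    have "?y k $$ (j, i) = ?y k $$ (i, j)" for k
      using sqrt_iter_sym[OF B sym, of k] yc[of k] ij by (metis carrier_matD index_transpose_mat(1))
    then have "Y $$ (j, i) = Y $$ (i, j)" using lim[OF ij] lim[OF ij(2,1)] LIMSEQ_unique by simp
    then show "Y\<^sup>T $$ (i, j) = Y $$ (i, j)" using ij Y by simp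
  qed (use Y in auto)
  have fix_point: "2 * Y $$ (i, j) = B $$ (i, j) + (Y * Y) $$ (i, j)" if ij: "i < n" "j < n" for i j
  proof -
    have mult: "(X * X) $$ (i, j) = (\<Sum>l<n. X $$ (i, l) * X $$ (l, j))"
      if "X \<in> carrier_mat n n" for X :: "real mat"
      using that ij by (simp add: scalar_prod_def atLeast0LessThan)
    have "(\<lambda>k. B $$ (i, j) + (\<Sum>l<n. ?y k $$ (i, l) * ?y k $$ (l, j)))
        \<longlonglongrightarrow> B $$ (i, j) + (\<Sum>l<n. Y $$ (i, l) * Y $$ (l, j))"
      using ij by (intro tendsto_intros lim) auto
    moreover have "B $$ (i, j) + (\<Sum>l<n. ?y k $$ (i, l) * ?y k $$ (l, j)) = 2 * ?y (Suc k) $$ (i, j)" for k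
      using ij B yc[of k] mult[OF yc[of k]] by simp
    ultimately have "(\<lambda>k. 2 * ?y (Suc k) $$ (i, j)) \<longlonglongrightarrow> B $$ (i, j) + (Y * Y) $$ (i, j)"
      using mult[OF Y] by (simp del: sqrt_iter.simps)
    moreover have "(\<lambda>k. 2 * ?y (Suc k) $$ (i, j)) \<longlonglongrightarrow> 2 * Y $$ (i, j)"
      by (intro tendsto_intros LIMSEQ_Suc lim ij)
    ultimately show ?thesis using LIMSEQ_unique by blast
  qed
  have form_le: "x \<bullet> (Y *\<^sub>v x) \<le> x \<bullet> x" if x: "x \<in> carrier_vec n" for x
  proof (rule LIMSEQ_le_const2)
    show "(\<lambda>k. x \<bullet> (?y k *\<^sub>v x)) \<longlonglongrightarrow> x \<bullet> (Y *\<^sub>v x)"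
      unfolding quad_form_sum[OF yc x x] quad_form_sum[OF Y x x]
      by (intro tendsto_intros lim) auto
    have "x \<bullet> (?y k *\<^sub>v x) \<le> x \<bullet> x" for k
    proof -
      have "x \<bullet> (?y k *\<^sub>v x) \<le> norm2 x * norm2 (?y k *\<^sub>v x)"
        using x yc[of k] by (intro scalar_prod_le_norm2[of _ n]) auto
      also have "\<dots> \<le> norm2 x * (r * norm2 x)"
        using sqrt_iter_bound[OF B q(1) r(1,3), of k] x
        by (intro mult_left_mono norm2_ge_0) (auto simp: op_bound_def)
      also have "\<dots> = r * (x \<bullet> x)" by (simp add: norm2_square[symmetric])
      also have "\<dots> \<le> 1 * (x \<bullet> x)" using r real_scalar_prod_ge_0 by (intro mult_right_mono) auto
      finally show ?thesis by simp
    qed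
    then show "\<exists>N. \<forall>k\<ge>N. x \<bullet> (?y k *\<^sub>v x) \<le> x \<bullet> x" by blast
  qed
  define R where "R = 1\<^sub>m n - Y"
  have R: "R \<in> carrier_mat n n" using Y by (auto simp: R_def)
  have "psd n R" unfolding psd_def
  proof (intro conjI ballI)
    show "R\<^sup>T = R" using Ysym Y by (simp add: R_def transpose_minus[of _ n n])
    fix x :: "real vec" assume x: "x \<in> carrier_vec n"
    have "R *\<^sub>v x = x - Y *\<^sub>v x"
      unfolding R_def using x Y minus_mult_distrib_mat_vec[of "1\<^sub>m n" n n Y x] by simp
    then have "x \<bullet> (R *\<^sub>v x) = x \<bullet> x - x \<bullet> (Y *\<^sub>v x)"
      using x Y by (simp add: scalar_prod_minus_distrib[of _ n])
    then show "0 \<le> x \<bullet> (R *\<^sub>v x)" using form_le[OF x] by simp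
  qed (rule R)
  moreover have "R * R = 1\<^sub>m n - B"
  proof (rule eq_matI)
    fix i j assume "i < dim_row (1\<^sub>m n - B)" "j < dim_col (1\<^sub>m n - B)"
    then have ij: "i < n" "j < n" using B by auto
    have "R * R = R - Y * R"
      using R Y minus_mult_distrib_mat[of "1\<^sub>m n" n n Y R n] by (simp add: R_def[symmetric])
    also have "Y * R = Y - Y * Y"
      unfolding R_def using Y mult_minus_distrib_mat[of Y n n "1\<^sub>m n" n Y] by simp
    finally have RR: "R * R = R - (Y - Y * Y)" .
    have YY: "Y * Y \<in> carrier_mat n n" using Y by auto
    have "(R * R) $$ (i, j) = R $$ (i, j) - (Y $$ (i, j) - (Y * Y) $$ (i, j))"
      unfolding RR using ij R carrier_matD[OF Y] carrier_matD[OF YY] by (simp del: index_mult_mat(1))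
    also have "\<dots> = (1\<^sub>m n - B) $$ (i, j)"
      using fix_point[OF ij] ij Y B by (simp add: R_def del: index_mult_mat(1))
    finally show "(R * R) $$ (i, j) = (1\<^sub>m n - B) $$ (i, j)" .
  qed (use R B in auto)
  ultimately show thesis by (rule that)
qed

text \<open>
  After division by an upper bound \<open>c\<close> of its form, a positive definite matrix is \<open>1 - B\<close> with \<open>B\<close>
  a positive semidefinite strict contraction.
\<close>

lemma pos_def_sqrt_exists:
  assumes A: "pos_def n A"
  obtains R where "psd n R" "R * R = A"
proof -
  have Ac: "A \<in> carrier_mat n n" and sym: "A\<^sup>T = A" using A by (auto simp: pos_def_def)
  obtain d where d: "0 < d" "\<And>x. x \<in> carrier_vec n \<Longrightarrow> d * (x \<bullet> x) \<le> x \<bullet> (A *\<^sub>v x)"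
    using pos_def_coercive[OF A] by blast
  \<comment> \<open>the summand \<open>d\<close> makes \<open>c\<close> positive even for \<open>n = 0\<close>, and ensures \<open>0 \<le> 1 - d / c\<close>\<close>
  define c where "c = (\<Sum>i<n. \<Sum>j<n. \<bar>A $$ (i, j)\<bar>) + d"
  have c: "0 < c" "d \<le> c" using d by (auto simp: c_def intro!: add_nonneg_pos sum_nonneg)
  have upper: "x \<bullet> (A *\<^sub>v x) \<le> c * (x \<bullet> x)" if "x \<in> carrier_vec n" for x
    using quad_form_le[OF Ac that] d(1) real_scalar_prod_ge_0[of x]
    by (simp add: c_def distrib_right add_increasing2)
  define B where "B = 1\<^sub>m n - (1 / c) \<cdot>\<^sub>m A"
  have B: "B \<in> carrier_mat n n" using Ac by (auto simp: B_def)
  have Bsym: "B\<^sup>T = B"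
  proof (rule eq_matI)
    fix i j assume "i < dim_row B" "j < dim_col B"
    then have ij: "i < n" "j < n" using B by auto
    have "A $$ (j, i) = A $$ (i, j)" using sym ij Ac by (metis carrier_matD index_transpose_mat(1))
    then show "B\<^sup>T $$ (i, j) = B $$ (i, j)" using ij Ac by (simp add: B_def)
  qed (use B in auto)
  have form: "x \<bullet> (B *\<^sub>v x) = x \<bullet> x - (x \<bullet> (A *\<^sub>v x)) / c" if x: "x \<in> carrier_vec n" for x
  proof -
    have "((1 / c) \<cdot>\<^sub>m A) *\<^sub>v x = (1 / c) \<cdot>\<^sub>v (A *\<^sub>v x)" using Ac x by (intro eq_vecI) auto
    then have "B *\<^sub>v x = x - (1 / c) \<cdot>\<^sub>v (A *\<^sub>v x)"
      unfolding B_def using x Ac minus_mult_distrib_mat_vec[of "1\<^sub>m n" n n "(1 / c) \<cdot>\<^sub>m A" x] by simp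
    then show ?thesis using x Ac by (simp add: scalar_prod_minus_distrib[of _ n])
  qed
  have "psd n B" unfolding psd_def
  proof (intro conjI ballI B Bsym)
    fix x :: "real vec" assume x: "x \<in> carrier_vec n"
    show "0 \<le> x \<bullet> (B *\<^sub>v x)" using upper[OF x] c by (simp add: form[OF x] field_simps)
  qed
  moreover have "x \<bullet> (B *\<^sub>v x) \<le> (1 - d / c) * (x \<bullet> x)" if x: "x \<in> carrier_vec n" for x
    using d(2)[OF x] c by (simp add: form[OF x] field_simps)
  ultimately have "op_bound n (1 - d / c) B"
    using c d by (intro psd_op_bound) (auto simp: field_simps)
  then obtain R where R: "psd n R" "R * R = 1\<^sub>m n - B"
    using psd_sqrt_of_contraction[OF B Bsym, of "1 - d / c"] c d by (auto simp: field_simps)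
  have Rc: "R \<in> carrier_mat n n" and Rsym: "R\<^sup>T = R" using R by (auto simp: psd_def)
  show thesis
  proof (rule that)
    show "psd n (sqrt c \<cdot>\<^sub>m R)" unfolding psd_def
    proof (intro conjI ballI)
      show "(sqrt c \<cdot>\<^sub>m R)\<^sup>T = sqrt c \<cdot>\<^sub>m R"
        by (subst (2) Rsym[symmetric]) (rule eq_matI, use Rc in auto)
      fix x :: "real vec" assume x: "x \<in> carrier_vec n"
      have "(sqrt c \<cdot>\<^sub>m R) *\<^sub>v x = sqrt c \<cdot>\<^sub>v (R *\<^sub>v x)" using Rc x by (intro eq_vecI) auto
      then show "0 \<le> x \<bullet> ((sqrt c \<cdot>\<^sub>m R) *\<^sub>v x)"
        using R(1) x Rc c by (simp add: psd_def)
    qed (use Rc in auto)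
    have "(sqrt c \<cdot>\<^sub>m R) * (sqrt c \<cdot>\<^sub>m R) = c \<cdot>\<^sub>m (R * R)"
      using Rc c by (simp add: mult_smult_distrib[of _ n n _ n] mult_smult_assoc_mat[of _ n n _ n] smult_mat_assoc)
    also have "\<dots> = A" unfolding R(2) B_def by (rule eq_matI) (use Ac c in auto)
    finally show "(sqrt c \<cdot>\<^sub>m R) * (sqrt c \<cdot>\<^sub>m R) = A" .
  qed
qed

lemma tr_add:
  assumes "A \<in> carrier_mat n n" "B \<in> carrier_mat n n"
  shows "tr (A + B) = tr A + tr B"
  using assms by (simp add: tr_def sum.distrib)

lemma tr_mult_comm:
  assumes "A \<in> carrier_mat n m" "B \<in> carrier_mat m n"
  shows "tr (A * B) = tr (B * A)"
proof -
  have "tr (A * B) = (\<Sum>i<n. \<Sum>j<m. A $$ (i, j) * B $$ (j, i))"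
    using assms by (simp add: tr_def scalar_prod_def atLeast0LessThan)
  also have "\<dots> = (\<Sum>j<m. \<Sum>i<n. B $$ (j, i) * A $$ (i, j))"
    by (subst sum.swap) (simp add: mult.commute)
  also have "\<dots> = tr (B * A)"
    using assms by (simp add: tr_def scalar_prod_def atLeast0LessThan)
  finally show ?thesis .
qed

lemma tr_congruence:
  assumes R: "R \<in> carrier_mat n n" and P: "P \<in> carrier_mat n m"
  shows "tr (P\<^sup>T * (R * P)) = (\<Sum>i<m. col P i \<bullet> (R *\<^sub>v col P i))"
proof -
  have "(P\<^sup>T * (R * P)) $$ (i, i) = col P i \<bullet> (R *\<^sub>v col P i)" if "i < m" for i
    using that R P col_mult2[OF R P that] by simp
  then show ?thesis using P by (simp add: tr_def)
qed

text \<open>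
  For two roots \<open>R\<close>, \<open>T\<close> with difference \<open>D\<close> one has \<open>R D + D T = R\<^sup>2 - T\<^sup>2 = 0\<close>. Multiplying by
  \<open>D\<close> and taking traces gives \<open>tr (D R D) + tr (D T D) = 0\<close>, where both traces are nonnegative.
  Hence \<open>R D = 0\<close>, so \<open>A D = R R D = 0\<close>, and \<open>A\<close> is invertible.
\<close>

lemma pos_def_sqrt_unique:
  assumes A: "pos_def n A" and R: "psd n R" "R * R = A" and T: "psd n T" "T * T = A"
  shows "R = T"
proof -
  have c: "R \<in> carrier_mat n n" "T \<in> carrier_mat n n" and sym: "R\<^sup>T = R" "T\<^sup>T = T"
    using R T by (auto simp: psd_def)
  define D where "D = R - T"
  have D: "D \<in> carrier_mat n n" using c by (auto simp: D_def)
  have Dsym: "D\<^sup>T = D" using c sym by (simp add: D_def transpose_minus[of _ n n])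
  have "R * D + D * T = 0\<^sub>m n n"
  proof -
    have "R * D = A - R * T"
      unfolding D_def R(2)[symmetric] using c by (simp add: mult_minus_distrib_mat[of _ n n _ n])
    moreover have "D * T = R * T - A"
      unfolding D_def T(2)[symmetric] using c by (simp add: minus_mult_distrib_mat[of _ n n _ _ n])
    moreover have "A \<in> carrier_mat n n" "R * T \<in> carrier_mat n n" using A c by (auto simp: pos_def_def)
    ultimately show ?thesis using c by (intro eq_matI) (auto simp del: index_mult_mat(1))
  qed
  have "D * (R * D) + D * (D * T) = D * (R * D + D * T)"
    using c D by (simp add: mult_add_distrib_mat[of _ n n _ n])
  also have "\<dots> = 0\<^sub>m n n" using D by (simp add: \<open>R * D + D * T = 0\<^sub>m n n\<close>)
  finally have "tr (D * (R * D) + D * (D * T)) = 0" by (simp add: tr_def)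
  moreover have "tr (D * (R * D) + D * (D * T)) = tr (D * (R * D)) + tr (D * (D * T))"
    using c D by (intro tr_add[of _ n]) auto
  moreover have "tr (D * (D * T)) = tr ((D * T) * D)"
    using c D by (intro tr_mult_comm[of _ n n]) auto
  moreover have "(D * T) * D = D * (T * D)" using c D by (intro assoc_mult_mat) auto
  ultimately have sum0: "tr (D\<^sup>T * (R * D)) + tr (D\<^sup>T * (T * D)) = 0"
    by (simp add: Dsym)
  have R_ge: "0 \<le> col D i \<bullet> (R *\<^sub>v col D i)" and T_ge: "0 \<le> col D i \<bullet> (T *\<^sub>v col D i)" if "i < n" for i
    using R(1) T(1) D that by (auto simp: psd_def)
  have "(\<Sum>i<n. col D i \<bullet> (R *\<^sub>v col D i)) = 0"
    using sum0 sum_nonneg[of "{..<n}" "\<lambda>i. col D i \<bullet> (R *\<^sub>v col D i)"] R_ge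
      sum_nonneg[of "{..<n}" "\<lambda>i. col D i \<bullet> (T *\<^sub>v col D i)"] T_ge
    unfolding tr_congruence[OF c(1) D] tr_congruence[OF c(2) D] by force
  then have R_zero: "col D i \<bullet> (R *\<^sub>v col D i) = 0" if "i < n" for i
    using R_ge that sum_nonneg_eq_0_iff[of "{..<n}" "\<lambda>i. col D i \<bullet> (R *\<^sub>v col D i)"] by auto
  have "col D i = 0\<^sub>v n" if i: "i < n" for i
  proof -
    have ci: "col D i \<in> carrier_vec n" using D i by auto
    have "R *\<^sub>v col D i = 0\<^sub>v n" by (rule psd_form_zero[OF R(1) ci R_zero[OF i]])
    then have "A *\<^sub>v col D i = R *\<^sub>v 0\<^sub>v n"
      using assoc_mult_mat_vec[OF c(1) c(1) ci] R(2) by simp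
    also have "\<dots> = 0\<^sub>v n" using c by (intro eq_vecI) auto
    finally have "A *\<^sub>v col D i = 0\<^sub>v n" .
    then have "minv A *\<^sub>v (0\<^sub>v n) = col D i" using pos_def_minv(5)[OF A ci] by simp
    moreover have "minv A *\<^sub>v (0\<^sub>v n) = 0\<^sub>v n"
      using pos_def_minv(1)[OF A] by (intro eq_vecI) auto
    ultimately show ?thesis by simp
  qed
  then have "D $$ (j, i) = 0" if "i < n" "j < n" for i j
    using that D by (metis carrier_matD index_col index_zero_vec(1))
  then show ?thesis using c by (intro eq_matI) (auto simp: D_def)
qed

lemma psd_sqrt_correct:
  assumes A: "pos_def n A"
  shows "psd n (psd_sqrt n A)" "psd_sqrt n A * psd_sqrt n A = A"
proof -
  have "\<exists>!R. psd n R \<and> R * R = A"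
    using pos_def_sqrt_exists[OF A] pos_def_sqrt_unique[OF A] by metis
  from theI'[OF this] show "psd n (psd_sqrt n A)" "psd_sqrt n A * psd_sqrt n A = A"
    by (simp_all add: psd_sqrt_def)
qed

text \<open>
  The right-hand side is the support function of the ellipsoid; this is where the norms in the
  constraints of the semidefinite program come from.
\<close>

lemma ellipsoid_scalar_prod_le:
  assumes A: "pos_def n A" and y: "y \<in> carrier_vec n" and z: "z \<in> ellipsoid n A"
  shows "\<bar>y \<bullet> z\<bar> \<le> norm2 (psd_sqrt n A *\<^sub>v y)"
proof -
  have zc: "z \<in> carrier_vec n" and z1: "z \<bullet> (minv A *\<^sub>v z) \<le> 1" using z by (auto simp: ellipsoid_def)
  have "0 \<le> y \<bullet> (A *\<^sub>v y)" using pos_def_imp_psd[OF A] y by (auto simp: psd_def)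
  then have "(y \<bullet> z)\<^sup>2 \<le> y \<bullet> (A *\<^sub>v y)"
    using pos_def_dual_cauchy_schwarz[OF A y zc] mult_left_mono[OF z1, of "y \<bullet> (A *\<^sub>v y)"] by simp
  then have "\<bar>y \<bullet> z\<bar> \<le> sqrt (y \<bullet> (A *\<^sub>v y))" by (metis real_sqrt_abs real_sqrt_le_mono)
  then show ?thesis using norm2_sqrt_apply[OF psd_sqrt_correct[OF A] y] by simp
qed

section \<open>Positions in stacked trajectories\<close>

lemma less_sum_split:
  fixes d :: "nat \<Rightarrow> nat"
  assumes "r < (\<Sum>k\<in>{1..N}. d k)"
  obtains i a where "i \<in> {1..N}" "a < d i" "r = (\<Sum>k\<in>{1..<i}. d k) + a"
proof -
  have "\<exists>i\<in>{1..N}. \<exists>a<d i. r = (\<Sum>k\<in>{1..<i}. d k) + a"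
    using assms
  proof (induction N)
    case (Suc N)
    have split: "(\<Sum>k\<in>{1..Suc N}. d k) = (\<Sum>k\<in>{1..N}. d k) + d (Suc N)" by simp
    show ?case
    proof (cases "r < (\<Sum>k\<in>{1..N}. d k)")
      case True
      with Suc.IH obtain i a where "i \<in> {1..N}" "a < d i" "r = (\<Sum>k\<in>{1..<i}. d k) + a" by blast
      then show ?thesis by (intro bexI[of _ i] exI[of _ a]) auto
    next
      case False
      moreover have "{1..<Suc N} = {1..N}" by auto
      ultimately show ?thesis using Suc.prems split
        by (intro bexI[of _ "Suc N"] exI[of _ "r - (\<Sum>k\<in>{1..N}. d k)"]) auto
    qed
  qed simp
  then show thesis using that by blast
qed

lemma offset_less:
  fixes d :: "nat \<Rightarrow> nat"
  assumes "1 \<le> i" "i \<le> N" "a < d i"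
  shows "(\<Sum>k\<in>{1..<i}. d k) + a < (\<Sum>k\<in>{1..N}. d k)"
proof -
  have "(\<Sum>k\<in>{1..<i}. d k) + a < (\<Sum>k\<in>{1..<Suc i}. d k)" using assms by simp
  also have "\<dots> \<le> (\<Sum>k\<in>{1..N}. d k)" using assms by (intro sum_mono2) auto
  finally show ?thesis .
qed

lemma pos_div:
  assumes "i \<in> subsys S" "a < d i"
  shows "pos S d t i a div (\<Sum>k\<in>subsys S. d k) = t"
    and "pos S d t i a mod (\<Sum>k\<in>subsys S. d k) = (\<Sum>k\<in>{1..<i}. d k) + a"
proof -
  have "(\<Sum>k\<in>{1..<i}. d k) + a < (\<Sum>k\<in>subsys S. d k)"
    using assms offset_less[of i "nsub S" a d] by (auto simp: subsys_def)
  then show "pos S d t i a div (\<Sum>k\<in>subsys S. d k) = t"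
    and "pos S d t i a mod (\<Sum>k\<in>subsys S. d k) = (\<Sum>k\<in>{1..<i}. d k) + a"
    by (simp_all add: pos_def add.assoc)
qed

text \<open>
  Time is the quotient by the dimension of one time block, and the remainder locates the subsystem
  among the partial sums of the dimensions.
\<close>

lemma pos_inj:
  assumes "i \<in> subsys S" "a < d i" "i' \<in> subsys S" "a' < d i'"
    and eq: "pos S d t i a = pos S d t' i' a'"
  shows "t = t' \<and> i = i' \<and> a = a'"
proof -
  have t: "t = t'" using pos_div(1)[of i S a d t] pos_div(1)[of i' S a' d t'] assms by simp
  have off: "(\<Sum>k\<in>{1..<i}. d k) + a = (\<Sum>k\<in>{1..<i'}. d k) + a'"
    using pos_div(2)[of i S a d t] pos_div(2)[of i' S a' d t'] assms by simp
  have "\<not> j < j'" if "1 \<le> j" "b < d j" "(\<Sum>k\<in>{1..<j}. d k) + b = (\<Sum>k\<in>{1..<j'}. d k) + b'" for j j' b b'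
  proof
    assume "j < j'"
    then obtain m where "j' = Suc m" "j \<le> m" by (metis Suc_leI less_imp_Suc_add le_add1 Suc_le_mono)
    moreover have "{1..<Suc m} = {1..m}" by auto
    ultimately show False using offset_less[of j m b d] that by simp
  qed
  then have "i = i'" using assms off by (metis atLeastAtMost_iff linorder_neqE_nat subsys_def)
  then show ?thesis using t off by simp
qed

lemma pos_bound:
  assumes "i \<in> subsys S" "a < d i" "t < h"
  shows "pos S d t i a < (\<Sum>k\<in>subsys S. d k) * h"
proof -
  have "(\<Sum>k\<in>{1..<i}. d k) + a < (\<Sum>k\<in>subsys S. d k)"
    using assms offset_less[of i "nsub S" a d] by (auto simp: subsys_def)
  then have "pos S d t i a < (\<Sum>k\<in>subsys S. d k) * Suc t"
    by (simp add: pos_def algebra_simps)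
  also have "\<dots> \<le> (\<Sum>k\<in>subsys S. d k) * h" using assms(3) by (intro mult_le_mono2) simp
  finally show ?thesis .
qed

lemma pos_cover:
  assumes "p < (\<Sum>k\<in>subsys S. d k) * h"
  obtains t i a where "t < h" "i \<in> subsys S" "a < d i" "p = pos S d t i a"
proof -
  let ?D = "\<Sum>k\<in>subsys S. d k"
  have D: "0 < ?D" using assms by (cases "?D = 0") auto
  obtain i a where ia: "i \<in> subsys S" "a < d i" "p mod ?D = (\<Sum>k\<in>{1..<i}. d k) + a"
    using less_sum_split[of "p mod ?D" d "nsub S"] D unfolding subsys_def
    by (metis mod_less_divisor)
  show thesis
  proof (rule that)
    show "p div ?D < h" using assms by (simp add: less_mult_imp_div_less mult.commute)
    show "p = pos S d (p div ?D) i a"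
      using ia(3) by (simp add: pos_def add.assoc[symmetric] flip: ia(3))
        (metis add.assoc div_mult_mod_eq ia(3))
  qed (use ia in auto)
qed

section \<open>Information structure of policies and contracts\<close>

lemma causal_space_entry:
  assumes "Q \<in> causal_space S nb" "t < hor S" "s \<le> hor S" "i \<in> subsys S" "j \<in> subsys S"
    and "a < udim S i" "b < xdim S j" "\<not> (s \<le> t \<and> j \<in> nb i)"
  shows "Q $$ (pos S (udim S) t i a, pos S (xdim S) s j b) = 0"
proof -
  have "mblk S (udim S) (xdim S) Q t s i j = 0\<^sub>m (udim S i) (xdim S j)"
    using assms by (auto simp: causal_space_def)
  then have "mblk S (udim S) (xdim S) Q t s i j $$ (a, b) = 0" using assms by simp
  then show ?thesis using assms by (simp add: mblk_def)
qed

lemma YC_entry: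
  assumes "Y \<in> YC S" "t \<le> hor S" "s \<le> hor S" "i \<in> subsys S" "j \<in> subsys S"
    and "a < xdim S i" "b < xdim S j" "t \<le> s \<or> \<not> VCout S i \<subseteq> VCout S j"
  shows "Y $$ (pos S (xdim S) t i a, pos S (xdim S) s j b) = 0"
proof -
  have "mblk S (xdim S) (xdim S) Y t s i j = 0\<^sub>m (xdim S i) (xdim S j)"
    using assms(1-5,8) unfolding YC_def by blast
  then have "mblk S (xdim S) (xdim S) Y t s i j $$ (a, b) = 0" using assms by simp
  then show ?thesis using assms by (simp add: mblk_def)
qed

text \<open>
  Position order refines time order, so strictly block lower triangular matrices are strictly lower
  triangular.
\<close>

lemma YC_strictly_lower:
  assumes Y: "Y \<in> YC S" and pq: "p \<le> q" "q < Nx S"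
  shows "Y $$ (p, q) = 0"
proof -
  obtain t i a where p: "t < hor S + 1" "i \<in> subsys S" "a < xdim S i" "p = pos S (xdim S) t i a"
    using pos_cover[of p "xdim S" S "hor S + 1"] pq by (auto simp: Nx_def)
  obtain s j b where q: "s < hor S + 1" "j \<in> subsys S" "b < xdim S j" "q = pos S (xdim S) s j b"
    using pos_cover[of q "xdim S" S "hor S + 1"] pq by (auto simp: Nx_def)
  have "t \<le> s"
    using div_le_mono[OF pq(1), of "\<Sum>k\<in>subsys S. xdim S k"]
      pos_div(1)[OF p(2), of a "xdim S" t] pos_div(1)[OF q(2), of b "xdim S" s] p q by simp
  then show ?thesis using YC_entry[OF Y] p q by auto
qed

lemma contract_matrix_invertible:
  assumes Y: "Y \<in> YC S" and lam: "0 < lam"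
  defines "Z \<equiv> lam \<cdot>\<^sub>m 1\<^sub>m (Nx S) - Y"
  shows "Z \<in> Zset S" "det Z \<noteq> 0"
proof -
  let ?n = "Nx S"
  have Yc: "Y \<in> carrier_mat ?n ?n" using Y by (simp add: YC_def)
  have Zc: "Z \<in> carrier_mat ?n ?n" using Yc by (auto simp: Z_def)
  have lower: "Z $$ (i, j) = 0" if "i < j" "j < ?n" for i j
    using that Yc YC_strictly_lower[OF Y, of i j] by (simp add: Z_def)
  have diag: "Z $$ (i, i) = lam" if "i < ?n" for i
    using that Yc YC_strictly_lower[OF Y, of i i] by (simp add: Z_def)
  have "det Z = prod_list (diag_mat Z)" by (rule det_lower_triangular[OF lower Zc])
  also have "\<dots> \<noteq> 0" using diag lam Zc by (auto simp: prod_list_zero_iff diag_mat_def)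
  finally show det: "det Z \<noteq> 0" .
  have "invertible_mat Z"
    unfolding invertible_mat_def inverts_mat_def
    using minv_inverse[OF Zc det] Zc by (auto intro!: exI[of _ "minv Z"])
  then show "Z \<in> Zset S"
    using lower Zc by (auto simp: Zset_def lower_triangular_def)
qed

text \<open>
  The matrix \<open>R = Q Z\<^sup>-\<^sup>1\<close> solves \<open>lam R = Q + R Y\<close>. As \<open>Y\<close> is strictly lower triangular, this
  equation computes column \<open>q\<close> of \<open>R\<close> from columns to its right, so the sparsity pattern can be
  checked by induction from the last column backwards. A nonzero term of \<open>R Y\<close> leads from
  subsystem \<open>i\<close> through some coupling component \<open>j'\<close> of \<open>i\<close> to a subsystem \<open>j\<close> with
  \<open>VCout j' \<subseteq> VCout j\<close>. Now \<open>j' \<in> Cset i\<close> means \<open>i \<in> VCout j'\<close>, hence \<open>i \<in> VCout j\<close>, that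
  is, \<open>j \<in> Cset i\<close>.
\<close>

lemma QC_mult_contract_inverse:
  assumes Q: "Q \<in> QC S" and Y: "Y \<in> YC S" and lam: "0 < lam"
  defines "Z \<equiv> lam \<cdot>\<^sub>m 1\<^sub>m (Nx S) - Y"
  shows "Q * minv Z \<in> QC S"
proof -
  let ?n = "Nx S"
  have Qc: "Q \<in> carrier_mat (Nu S) ?n" using Q by (simp add: QC_def causal_space_def)
  have Yc: "Y \<in> carrier_mat ?n ?n" using Y by (simp add: YC_def)
  have Zc: "Z \<in> carrier_mat ?n ?n" using Yc by (auto simp: Z_def)
  have det: "det Z \<noteq> 0" unfolding Z_def by (rule contract_matrix_invertible(2)[OF Y lam])
  note inv = minv_inverse[OF Zc det]
  define R where "R = Q * minv Z"
  have Rc: "R \<in> carrier_mat (Nu S) ?n" using Qc inv by (auto simp: R_def)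
  have RY: "R * Y \<in> carrier_mat (Nu S) ?n" using Rc Yc by auto
  have "R * Z = Q" using assoc_mult_mat[OF Qc inv(1) Zc] inv(3) Qc by (simp add: R_def)
  moreover have "R * Z = R * (lam \<cdot>\<^sub>m 1\<^sub>m ?n) - R * Y"
    unfolding Z_def using Rc Yc by (intro mult_minus_distrib_mat) auto
  moreover have "R * (lam \<cdot>\<^sub>m 1\<^sub>m ?n) = lam \<cdot>\<^sub>m R"
    using Rc mult_smult_distrib[of R "Nu S" ?n "1\<^sub>m ?n" ?n lam] by simp
  ultimately have RZ: "lam \<cdot>\<^sub>m R - R * Y = Q" by simp
  have rec: "lam * R $$ (p, q) = Q $$ (p, q) + (\<Sum>l<?n. R $$ (p, l) * Y $$ (l, q))"
    if "p < Nu S" "q < ?n" for p q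
  proof -
    have "Q $$ (p, q) = lam * R $$ (p, q) - (R * Y) $$ (p, q)"
      using that Rc carrier_matD[OF RY] by (subst RZ[symmetric]) (simp del: index_mult_mat(1))
    moreover have "(R * Y) $$ (p, q) = (\<Sum>l<?n. R $$ (p, l) * Y $$ (l, q))"
      using that Rc Yc by (simp add: scalar_prod_def atLeast0LessThan)
    ultimately show ?thesis by simp
  qed
  have zero: "R $$ (pos S (udim S) t i a, pos S (xdim S) s j b) = 0"
    if t: "t < hor S" and i: "i \<in> subsys S" and a: "a < udim S i"
      and s: "s \<le> hor S" and j: "j \<in> subsys S" and b: "b < xdim S j"
      and out: "\<not> (s \<le> t \<and> j \<in> Cset S i)" for t i a s j b
    using s j b out
  proof (induction "?n - pos S (xdim S) s j b" arbitrary: s j b rule: less_induct)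
    case less
    let ?p = "pos S (udim S) t i a" and ?q = "pos S (xdim S) s j b"
    have p: "?p < Nu S" using pos_bound[where d="udim S", OF i a t] by (simp add: Nu_def)
    have q: "?q < ?n" using pos_bound[where d="xdim S" and h="hor S + 1"] less.prems by (simp add: Nx_def)
    have "R $$ (?p, l) * Y $$ (l, ?q) = 0" if l: "l < ?n" for l
    proof (cases "Y $$ (l, ?q) = 0")
      case False
      then have "?q < l" using YC_strictly_lower[OF Y _ q, of l] by fastforce
      obtain s' j' b' where l': "s' < hor S + 1" "j' \<in> subsys S" "b' < xdim S j'" "l = pos S (xdim S) s' j' b'"
        using pos_cover[of l "xdim S" S "hor S + 1"] l by (auto simp: Nx_def)
      have "\<not> (s' \<le> s \<or> \<not> VCout S j' \<subseteq> VCout S j)"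
        using YC_entry[OF Y _ less.prems(1) l'(2) less.prems(2) l'(3) less.prems(3), of s'] False l'
        by auto
      then have dep: "s < s'" "VCout S j' \<subseteq> VCout S j" by auto
      have "\<not> (s' \<le> t \<and> j' \<in> Cset S i)"
      proof
        assume "s' \<le> t \<and> j' \<in> Cset S i"
        then have "i \<in> VCout S j'" by (auto simp: VCout_def EC_def Cset_def VI_def)
        then have "i \<in> VCout S j" using dep by blast
        then have "j \<in> Cset S i" by (simp add: VCout_def EC_def)
        then show False using less.prems(4) \<open>s' \<le> t \<and> j' \<in> Cset S i\<close> dep(1) by auto
      qed
      then have "R $$ (?p, l) = 0"
        using less.hyps[of s' j' b'] l' \<open>?q < l\<close> l by auto
      then show ?thesis by simp
    qed simp
    then have "(\<Sum>l<?n. R $$ (?p, l) * Y $$ (l, ?q)) = 0" by (intro sum.neutral) auto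
    moreover have "Q $$ (?p, ?q) = 0"
      using causal_space_entry[of Q S "Cset S"] Q t i a less.prems by (auto simp: QC_def)
    ultimately show ?case using rec[OF p q] lam by simp
  qed
  then show ?thesis
    unfolding R_def[symmetric] QC_def causal_space_def
    using Rc by (auto simp: mblk_def intro!: eq_matI)
qed

section \<open>The projection onto the coupling components\<close>

lemma distinct_concat_map:
  assumes "distinct xs" "\<And>x. x \<in> set xs \<Longrightarrow> distinct (f x)"
    and "\<And>x y. x \<in> set xs \<Longrightarrow> y \<in> set xs \<Longrightarrow> x \<noteq> y \<Longrightarrow> set (f x) \<inter> set (f y) = {}"
  shows "distinct (concat (map f xs))"
  using assms
proof (induction xs)
  case (Cons x xs)
  moreover have "set (f x) \<inter> set (f y) = {}" if "y \<in> set xs" for y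
    using Cons.prems that by (intro Cons.prems(3)) auto
  ultimately show ?case by auto
qed simp

lemma Call_subsys:
  assumes "netsys_ok S"
  shows "Call S \<subseteq> subsys S"
  using assms by (auto simp: netsys_ok_def Call_def Cset_def VI_def)

lemma C_positions_props:
  assumes S: "netsys_ok S"
  shows "distinct (C_positions S)" "set (C_positions S) \<subseteq> {..<Nx S}"
proof -
  have fin: "finite (Call S)" using Call_subsys[OF S] by (rule finite_subset) (simp add: subsys_def)
  have js: "set (sorted_list_of_set (Call S)) \<subseteq> subsys S" using Call_subsys[OF S] fin by simp
  show "distinct (C_positions S)"
    unfolding C_positions_def
    by (intro distinct_concat_map)
      (use js in \<open>auto simp: distinct_map inj_on_def dest!: pos_inj[rotated 4]\<close>)
  show "set (C_positions S) \<subseteq> {..<Nx S}"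
    using js pos_bound[where d="xdim S" and h="hor S + 1"]
    by (auto simp: C_positions_def Nx_def)
qed

lemma PiC_carrier: "PiC S \<in> carrier_mat (NxC S) (Nx S)"
  by (simp add: PiC_def)

text \<open>
  The projection selects each coordinate at most once, so its rows are orthonormal. Full row rank is
  needed to invert the shape matrix of the projected ellipsoid.
\<close>

lemma PiC_mult_transpose:
  assumes S: "netsys_ok S"
  shows "PiC S * (PiC S)\<^sup>T = 1\<^sub>m (NxC S)"
proof (rule eq_matI)
  fix r r' assume "r < dim_row (1\<^sub>m (NxC S))" "r' < dim_col (1\<^sub>m (NxC S))"
  then have r: "r < NxC S" "r' < NxC S" by auto
  have lt: "C_positions S ! k < Nx S" if "k < NxC S" for k
    using C_positions_props(2)[OF S] that unfolding NxC_def by (meson lessThan_iff nth_mem subsetD)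
  have row: "row (PiC S) k = unit_vec (Nx S) (C_positions S ! k)" if "k < NxC S" for k
    using that lt by (intro eq_vecI) (auto simp: PiC_def)
  have "(PiC S * (PiC S)\<^sup>T) $$ (r, r') = row (PiC S) r \<bullet> row (PiC S) r'"
    using r PiC_carrier[of S] by simp
  also have "\<dots> = (1\<^sub>m (NxC S)) $$ (r, r')"
    using r lt nth_eq_iff_index_eq[OF C_positions_props(1)[OF S]]
    by (auto simp: row NxC_def)
  finally show "(PiC S * (PiC S)\<^sup>T) $$ (r, r') = (1\<^sub>m (NxC S)) $$ (r, r')" .
qed (use PiC_carrier[of S] in auto)

section \<open>Ellipsoids under projection and the linear matrix inequality\<close>

lemma append_cols_mult_vec:
  assumes G: "G \<in> carrier_mat m n" and H: "H \<in> carrier_mat m k"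
    and b: "b \<in> carrier_vec n" and c: "c \<in> carrier_vec k"
  shows "append_cols G H *\<^sub>v (b @\<^sub>v c) = G *\<^sub>v b + H *\<^sub>v c"
proof -
  have "append_cols G H *\<^sub>v (b @\<^sub>v c)
      = (G *\<^sub>v b + H *\<^sub>v c) @\<^sub>v ((0\<^sub>m 0 n) *\<^sub>v b + (0\<^sub>m 0 k) *\<^sub>v c)"
    using G H b c four_block_mat_mult_vec[OF G H, of "0\<^sub>m 0 n" 0 "0\<^sub>m 0 k" b c]
    by (simp add: append_cols_def)
  also have "\<dots> = G *\<^sub>v b + H *\<^sub>v c" using G H by (intro eq_vecI) auto
  finally show ?thesis .
qed

lemma block_psd_form:
  fixes K :: "real mat"
  assumes K: "K \<in> carrier_mat m m" and G: "G \<in> carrier_mat m n" and H: "H \<in> carrier_mat m n"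
    and D: "D1 \<in> carrier_mat n n" "D2 \<in> carrier_mat n n"
    and psd: "psd (m + (n + n)) (four_block_mat K (append_cols G H) (G\<^sup>T @\<^sub>r H\<^sup>T)
      (four_block_mat D1 (0\<^sub>m n n) (0\<^sub>m n n) D2))"
    and a: "a \<in> carrier_vec m" and b: "b \<in> carrier_vec n" and c: "c \<in> carrier_vec n"
  shows "0 \<le> a \<bullet> (K *\<^sub>v a) + 2 * (a \<bullet> (G *\<^sub>v b + H *\<^sub>v c)) + b \<bullet> (D1 *\<^sub>v b) + c \<bullet> (D2 *\<^sub>v c)"
proof -
  let ?D = "four_block_mat D1 (0\<^sub>m n n) (0\<^sub>m n n) D2"
  let ?z = "a @\<^sub>v (b @\<^sub>v c)"
  have GH: "append_cols G H \<in> carrier_mat m (n + n)"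
    using four_block_carrier_mat[OF G, of "0\<^sub>m 0 n" 0 n "H" "0\<^sub>m 0 n"] G H
    by (auto simp: append_cols_def)
  have GHT: "G\<^sup>T @\<^sub>r H\<^sup>T \<in> carrier_mat (n + n) m" using G H by (intro carrier_append_rows) auto
  have Dc: "?D \<in> carrier_mat (n + n) (n + n)" using D by auto
  have bc: "b @\<^sub>v c \<in> carrier_vec (n + n)" using b c by auto
  have D_apply: "?D *\<^sub>v (b @\<^sub>v c) = (D1 *\<^sub>v b) @\<^sub>v (D2 *\<^sub>v c)"
  proof -
    have "0\<^sub>m n n *\<^sub>v c = 0\<^sub>v n" "0\<^sub>m n n *\<^sub>v b = 0\<^sub>v n" using b c by (auto intro!: eq_vecI)
    moreover have "D1 *\<^sub>v b \<in> carrier_vec n" "D2 *\<^sub>v c \<in> carrier_vec n" using D b c by auto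
    ultimately show ?thesis
      by (subst four_block_mat_mult_vec[OF D(1) _ _ D(2) b c]) auto
  qed
  have "0 \<le> ?z \<bullet> (four_block_mat K (append_cols G H) (G\<^sup>T @\<^sub>r H\<^sup>T) ?D *\<^sub>v ?z)"
    using psd a bc by (auto simp: psd_def)
  also have "four_block_mat K (append_cols G H) (G\<^sup>T @\<^sub>r H\<^sup>T) ?D *\<^sub>v ?z
      = (K *\<^sub>v a + (G *\<^sub>v b + H *\<^sub>v c))
        @\<^sub>v (((G\<^sup>T *\<^sub>v a) @\<^sub>v (H\<^sup>T *\<^sub>v a)) + ((D1 *\<^sub>v b) @\<^sub>v (D2 *\<^sub>v c)))"
    using four_block_mat_mult_vec[OF K GH GHT Dc a bc] append_cols_mult_vec[OF G H b c]
      mat_mult_append[of "G\<^sup>T" n m "H\<^sup>T" n a] G H a D_apply by simp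
  also have "((G\<^sup>T *\<^sub>v a) @\<^sub>v (H\<^sup>T *\<^sub>v a)) + ((D1 *\<^sub>v b) @\<^sub>v (D2 *\<^sub>v c))
      = (G\<^sup>T *\<^sub>v a + D1 *\<^sub>v b) @\<^sub>v (H\<^sup>T *\<^sub>v a + D2 *\<^sub>v c)"
    using G H D by (intro eq_vecI) auto
  also have "?z \<bullet> ((K *\<^sub>v a + (G *\<^sub>v b + H *\<^sub>v c)) @\<^sub>v ((G\<^sup>T *\<^sub>v a + D1 *\<^sub>v b) @\<^sub>v (H\<^sup>T *\<^sub>v a + D2 *\<^sub>v c)))
      = a \<bullet> (K *\<^sub>v a + (G *\<^sub>v b + H *\<^sub>v c))
        + (b \<bullet> (G\<^sup>T *\<^sub>v a + D1 *\<^sub>v b) + c \<bullet> (H\<^sup>T *\<^sub>v a + D2 *\<^sub>v c))"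
    using a b c K G H D
    by (subst scalar_prod_append[of _ m _ "n + n"], auto)
      (subst scalar_prod_append[of _ n _ n], auto)
  also have "\<dots> = a \<bullet> (K *\<^sub>v a) + (a \<bullet> (G *\<^sub>v b) + a \<bullet> (H *\<^sub>v c))
        + ((b \<bullet> (G\<^sup>T *\<^sub>v a) + b \<bullet> (D1 *\<^sub>v b)) + (c \<bullet> (H\<^sup>T *\<^sub>v a) + c \<bullet> (D2 *\<^sub>v c)))"
    using a b c K G H D
    by (simp add: scalar_prod_add_distrib[of _ m] scalar_prod_add_distrib[of _ n])
  also have "b \<bullet> (G\<^sup>T *\<^sub>v a) = a \<bullet> (G *\<^sub>v b)" using scalar_prod_transpose[OF G a b] by simp
  also have "c \<bullet> (H\<^sup>T *\<^sub>v a) = a \<bullet> (H *\<^sub>v c)" using scalar_prod_transpose[OF H a c] by simp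
  finally show ?thesis
    using a b c G H by (simp add: scalar_prod_add_distrib[of _ m])
qed

text \<open>
  \<open>Z Sig Z\<^sup>T = lam (lam Sig - Y Sig - Sig Y\<^sup>T) + Y Sig Y\<^sup>T\<close>, so dropping the positive semidefinite
  last term bounds the shape matrix \<open>Z Sig Z\<^sup>T\<close> from below by an expression affine in \<open>Y\<close>, the
  one that appears in the linear matrix inequality. The semidefinite program is conservative here.
\<close>

lemma shape_form_le:
  fixes lam :: real
  assumes Sig: "pos_def n Sig" and Y: "Y \<in> carrier_mat n n" and y: "y \<in> carrier_vec n"
  defines "Z \<equiv> lam \<cdot>\<^sub>m 1\<^sub>m n - Y"
  shows "lam * (y \<bullet> ((lam \<cdot>\<^sub>m Sig - Y * Sig - Sig * Y\<^sup>T) *\<^sub>v y))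
    \<le> (Z\<^sup>T *\<^sub>v y) \<bullet> (Sig *\<^sub>v (Z\<^sup>T *\<^sub>v y))"
proof -
  have Sc: "Sig \<in> carrier_mat n n" and sym: "Sig\<^sup>T = Sig" using Sig by (auto simp: pos_def_def)
  define e where "e = Y\<^sup>T *\<^sub>v y"
  have e: "e \<in> carrier_vec n" using Y y by (auto simp: e_def)
  have Sy: "Sig *\<^sub>v y \<in> carrier_vec n" and Se: "Sig *\<^sub>v e \<in> carrier_vec n" using Sc y e by auto
  have Zy: "Z\<^sup>T *\<^sub>v y = lam \<cdot>\<^sub>v y - e"
  proof -
    have "Z\<^sup>T = lam \<cdot>\<^sub>m 1\<^sub>m n - Y\<^sup>T" unfolding Z_def using Y by (intro eq_matI) auto
    moreover have "(lam \<cdot>\<^sub>m 1\<^sub>m n) *\<^sub>v y = lam \<cdot>\<^sub>v y" using y by (intro eq_vecI) auto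
    ultimately show ?thesis
      using Y y minus_mult_distrib_mat_vec[of "lam \<cdot>\<^sub>m 1\<^sub>m n" n n "Y\<^sup>T" y] by (simp add: e_def)
  qed
  have cross: "y \<bullet> (Sig *\<^sub>v e) = e \<bullet> (Sig *\<^sub>v y)" using scalar_prod_transpose[OF Sc y e] sym by simp
  have "Sig *\<^sub>v (lam \<cdot>\<^sub>v y - e) = lam \<cdot>\<^sub>v (Sig *\<^sub>v y) - Sig *\<^sub>v e"
    using Sc y e by (simp add: mult_minus_distrib_mat_vec[of _ n n] mult_mat_vec[of _ n n])
  then have lhs: "(Z\<^sup>T *\<^sub>v y) \<bullet> (Sig *\<^sub>v (Z\<^sup>T *\<^sub>v y))
      = lam * (lam * (y \<bullet> (Sig *\<^sub>v y))) - 2 * lam * (e \<bullet> (Sig *\<^sub>v y)) + e \<bullet> (Sig *\<^sub>v e)"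
    unfolding Zy using y e Sy Se cross
    by (simp add: minus_scalar_prod_distrib[of _ n] scalar_prod_minus_distrib[of _ n] algebra_simps)
  have "(lam \<cdot>\<^sub>m Sig - Y * Sig - Sig * Y\<^sup>T) *\<^sub>v y = lam \<cdot>\<^sub>v (Sig *\<^sub>v y) - Y *\<^sub>v (Sig *\<^sub>v y) - Sig *\<^sub>v e"
  proof -
    have "(lam \<cdot>\<^sub>m Sig) *\<^sub>v y = lam \<cdot>\<^sub>v (Sig *\<^sub>v y)" using Sc y by (intro eq_vecI) auto
    moreover have "(lam \<cdot>\<^sub>m Sig - Y * Sig - Sig * Y\<^sup>T) *\<^sub>v y
        = (lam \<cdot>\<^sub>m Sig - Y * Sig) *\<^sub>v y - (Sig * Y\<^sup>T) *\<^sub>v y"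
      using Sc Y y by (intro minus_mult_distrib_mat_vec) auto
    moreover have "(lam \<cdot>\<^sub>m Sig - Y * Sig) *\<^sub>v y = (lam \<cdot>\<^sub>m Sig) *\<^sub>v y - (Y * Sig) *\<^sub>v y"
      using Sc Y y by (intro minus_mult_distrib_mat_vec) auto
    moreover have "(Y * Sig) *\<^sub>v y = Y *\<^sub>v (Sig *\<^sub>v y)" "(Sig * Y\<^sup>T) *\<^sub>v y = Sig *\<^sub>v e"
      using Sc Y y by (auto simp: e_def intro!: assoc_mult_mat_vec)
    ultimately show ?thesis by simp
  qed
  moreover have YSy: "Y *\<^sub>v (Sig *\<^sub>v y) \<in> carrier_vec n" using Y Sy by auto
  moreover have "y \<bullet> (Y *\<^sub>v (Sig *\<^sub>v y)) = e \<bullet> (Sig *\<^sub>v y)"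
    unfolding e_def using transpose_vec_mult_scalar[OF Y Sy y] by simp
  ultimately have "y \<bullet> ((lam \<cdot>\<^sub>m Sig - Y * Sig - Sig * Y\<^sup>T) *\<^sub>v y)
      = lam * (y \<bullet> (Sig *\<^sub>v y)) - 2 * (e \<bullet> (Sig *\<^sub>v y))"
    using y Sy Se cross by (simp add: scalar_prod_minus_distrib[of _ n])
  moreover have "0 \<le> e \<bullet> (Sig *\<^sub>v e)" using pos_def_imp_psd[OF Sig] e by (auto simp: psd_def)
  ultimately show ?thesis unfolding lhs by (simp add: right_diff_distrib)
qed

text \<open>
  The image of the ellipsoid under \<open>G\<close> has shape matrix \<open>K = G Sig G\<^sup>T\<close>, and the hypothesis on
  \<open>p\<close> is the support function inequality for that image. Taking
  \<open>a = K\<^sup>-\<^sup>1 p\<close> in it bounds \<open>p \<bullet> K\<^sup>-\<^sup>1 p\<close> by \<open>1\<close>, and this number is the value of the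
  quadratic form that defines the ellipsoid at the explicit preimage \<open>Sig G\<^sup>T K\<^sup>-\<^sup>1 p\<close>.
\<close>

lemma linear_image_ellipsoid_member:
  assumes Sig: "pos_def n Sig" and G: "G \<in> carrier_mat m n"
    and inj: "\<And>a. a \<in> carrier_vec m \<Longrightarrow> G\<^sup>T *\<^sub>v a = 0\<^sub>v n \<Longrightarrow> a = 0\<^sub>v m"
    and p: "p \<in> carrier_vec m"
    and supp: "\<And>a. a \<in> carrier_vec m \<Longrightarrow> (a \<bullet> p)\<^sup>2 \<le> (G\<^sup>T *\<^sub>v a) \<bullet> (Sig *\<^sub>v (G\<^sup>T *\<^sub>v a))"
  shows "\<exists>z\<in>ellipsoid n Sig. G *\<^sub>v z = p"
proof -
  have Sc: "Sig \<in> carrier_mat n n" and sym: "Sig\<^sup>T = Sig" using Sig by (auto simp: pos_def_def)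
  define K where "K = G * (Sig * G\<^sup>T)"
  have K: "K \<in> carrier_mat m m" using G Sc by (auto simp: K_def)
  have apply_K: "K *\<^sub>v a = G *\<^sub>v (Sig *\<^sub>v (G\<^sup>T *\<^sub>v a))" if a: "a \<in> carrier_vec m" for a
    unfolding K_def using G Sc a by (simp add: assoc_mult_mat_vec[of _ m n _ m] assoc_mult_mat_vec[of _ n n _ m])
  have form_K: "a \<bullet> (K *\<^sub>v a) = (G\<^sup>T *\<^sub>v a) \<bullet> (Sig *\<^sub>v (G\<^sup>T *\<^sub>v a))" if a: "a \<in> carrier_vec m" for a
  proof -
    have "Sig *\<^sub>v (G\<^sup>T *\<^sub>v a) \<in> carrier_vec n" using G Sc a by auto
    then show ?thesis unfolding apply_K[OF a] using transpose_vec_mult_scalar[OF G _ a] by simp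
  qed
  have "pos_def m K" unfolding pos_def_def
  proof (intro conjI ballI impI K)
    have "K\<^sup>T = (Sig * G\<^sup>T)\<^sup>T * G\<^sup>T"
      unfolding K_def using G Sc by (intro transpose_mult[of _ m n _ m]) auto
    also have "(Sig * G\<^sup>T)\<^sup>T = G * Sig"
      using G Sc sym transpose_mult[of Sig n n "G\<^sup>T" m] by simp
    finally show "K\<^sup>T = K" unfolding K_def using G Sc by (simp add: assoc_mult_mat[of _ m n _ n _ m])
    fix a :: "real vec" assume a: "a \<in> carrier_vec m" "a \<noteq> 0\<^sub>v m"
    then have "G\<^sup>T *\<^sub>v a \<noteq> 0\<^sub>v n" "G\<^sup>T *\<^sub>v a \<in> carrier_vec n" using inj G by auto
    then show "0 < a \<bullet> (K *\<^sub>v a)" using Sig unfolding form_K[OF a(1)] by (auto simp: pos_def_def)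
  qed
  note invK = pos_def_minv[OF this]
  define a where "a = minv K *\<^sub>v p"
  have a: "a \<in> carrier_vec m" using invK(1) p by (auto simp: a_def)
  have Ka: "K *\<^sub>v a = p" using invK(4)[OF p] by (simp add: a_def)
  define q where "q = G\<^sup>T *\<^sub>v a"
  have q: "q \<in> carrier_vec n" using G a by (auto simp: q_def)
  have Sq: "Sig *\<^sub>v q \<in> carrier_vec n" using Sc q by auto
  have qq: "q \<bullet> (Sig *\<^sub>v q) = a \<bullet> p" using form_K[OF a] Ka by (simp add: q_def)
  have "(a \<bullet> p)\<^sup>2 \<le> a \<bullet> p" using supp[OF a] qq by (simp add: q_def)
  then have "a \<bullet> p \<le> 1"
    using mult_strict_right_mono[of 1 "a \<bullet> p" "a \<bullet> p"]
    by (cases "1 < a \<bullet> p") (auto simp: power2_eq_square)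
  moreover have "(Sig *\<^sub>v q) \<bullet> (minv Sig *\<^sub>v (Sig *\<^sub>v q)) = a \<bullet> p"
    using pos_def_minv(5)[OF Sig q] comm_scalar_prod[OF Sq q] qq by simp
  ultimately have "Sig *\<^sub>v q \<in> ellipsoid n Sig" using Sq by (simp add: ellipsoid_def)
  moreover have "G *\<^sub>v (Sig *\<^sub>v q) = p" using Ka apply_K[OF a] by (simp add: q_def)
  ultimately show ?thesis by blast
qed

text \<open>
  The hypothesis bounds \<open>2 (a \<bullet> p)\<close> by the sum of \<open>lam\<close> and a quadratic form. Inserting all
  multiples of \<open>a\<close> gives a bound on \<open>(a \<bullet> p)\<^sup>2\<close> by their product, and there \<open>lam\<close> cancels
  against the factor in the lower bound on \<open>Z Sig Z\<^sup>T\<close>. What is left is the support function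
  inequality for the image of the ellipsoid under \<open>P Z\<close>.
\<close>

lemma projected_contract_member:
  fixes lam :: real
  assumes Sig: "pos_def n Sig" and Y: "Y \<in> carrier_mat n n" and lam: "0 < lam"
    and P: "P \<in> carrier_mat m n" and PP: "P * P\<^sup>T = 1\<^sub>m m" and p: "p \<in> carrier_vec m"
    and det: "det (lam \<cdot>\<^sub>m 1\<^sub>m n - Y) \<noteq> 0"
    and supp: "\<And>a. a \<in> carrier_vec m \<Longrightarrow>
      2 * (a \<bullet> p) \<le> lam + a \<bullet> ((P * (lam \<cdot>\<^sub>m Sig - Y * Sig - Sig * Y\<^sup>T) * P\<^sup>T) *\<^sub>v a)"
  shows "\<exists>z\<in>ellipsoid n Sig. P *\<^sub>v ((lam \<cdot>\<^sub>m 1\<^sub>m n - Y) *\<^sub>v z) = p"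
proof -
  define Z where "Z = lam \<cdot>\<^sub>m 1\<^sub>m n - Y"
  define T where "T = lam \<cdot>\<^sub>m Sig - Y * Sig - Sig * Y\<^sup>T"
  have Sc: "Sig \<in> carrier_mat n n" using Sig by (auto simp: pos_def_def)
  have Z: "Z \<in> carrier_mat n n" using Y by (auto simp: Z_def)
  have T: "T \<in> carrier_mat n n" using Y Sc by (auto simp: T_def)
  have PZ: "P * Z \<in> carrier_mat m n" using P Z by auto
  have PZT: "(P * Z)\<^sup>T *\<^sub>v a = Z\<^sup>T *\<^sub>v (P\<^sup>T *\<^sub>v a)" if a: "a \<in> carrier_vec m" for a
    using P Z a transpose_mult[OF P Z] by (simp add: assoc_mult_mat_vec[of _ n n _ m])
  have "\<exists>z\<in>ellipsoid n Sig. (P * Z) *\<^sub>v z = p"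
  proof (rule linear_image_ellipsoid_member[OF Sig PZ _ p])
    fix a :: "real vec" assume a: "a \<in> carrier_vec m"
    define y where "y = P\<^sup>T *\<^sub>v a"
    have y: "y \<in> carrier_vec n" using P a by (auto simp: y_def)
    define k where "k = (Z\<^sup>T *\<^sub>v y) \<bullet> (Sig *\<^sub>v (Z\<^sup>T *\<^sub>v y))"
    have k: "0 \<le> k" using pos_def_imp_psd[OF Sig] Z y by (auto simp: k_def psd_def)
    have "a \<bullet> ((P * T * P\<^sup>T) *\<^sub>v a) = y \<bullet> (T *\<^sub>v y)"
    proof -
      have Ty: "T *\<^sub>v y \<in> carrier_vec n" using T y by auto
      have "(P * T * P\<^sup>T) *\<^sub>v a = (P * T) *\<^sub>v (P\<^sup>T *\<^sub>v a)"
        by (rule assoc_mult_mat_vec) (use P T a in auto)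
      also have "\<dots> = P *\<^sub>v (T *\<^sub>v y)"
        unfolding y_def[symmetric] by (rule assoc_mult_mat_vec) (use P T y in auto)
      finally show ?thesis using transpose_vec_mult_scalar[OF P Ty a] by (simp add: y_def)
    qed
    moreover have "lam * (y \<bullet> (T *\<^sub>v y)) \<le> k"
      unfolding T_def k_def Z_def by (rule shape_form_le[OF Sig Y y])
    ultimately have form: "a \<bullet> ((P * T * P\<^sup>T) *\<^sub>v a) \<le> k / lam"
      using lam by (simp add: field_simps)
    \<comment> \<open>the hypothesis at \<open>- t \<cdot>\<^sub>v a\<close>, for all \<open>t\<close>, is a nonnegative quadratic in \<open>t\<close>\<close>
    have "(a \<bullet> p)\<^sup>2 \<le> lam * (k / lam)"
    proof (rule nonneg_quadratic_discriminant)
      fix t :: real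
      have "2 * ((- t \<cdot>\<^sub>v a) \<bullet> p) \<le> lam + (- t \<cdot>\<^sub>v a) \<bullet> ((P * T * P\<^sup>T) *\<^sub>v (- t \<cdot>\<^sub>v a))"
        unfolding T_def using a by (intro supp) auto
      also have "(- t \<cdot>\<^sub>v a) \<bullet> ((P * T * P\<^sup>T) *\<^sub>v (- t \<cdot>\<^sub>v a)) = t\<^sup>2 * (a \<bullet> ((P * T * P\<^sup>T) *\<^sub>v a))"
      proof -
        have PTP: "P * T * P\<^sup>T \<in> carrier_mat m m" using P T by auto
        have PTPa: "(P * T * P\<^sup>T) *\<^sub>v a \<in> carrier_vec m" using PTP a by auto
        show ?thesis
          unfolding mult_mat_vec[OF PTP a]
          using a PTPa by (simp add: power2_eq_square)
      qed
      also have "\<dots> \<le> t\<^sup>2 * (k / lam)" by (intro mult_left_mono form) auto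
      also have "(- t \<cdot>\<^sub>v a) \<bullet> p = - t * (a \<bullet> p)" using a p by simp
      finally show "0 \<le> lam + 2 * t * (a \<bullet> p) + t\<^sup>2 * (k / lam)" by simp
    qed (use k lam in auto)
    then show "(a \<bullet> p)\<^sup>2 \<le> ((P * Z)\<^sup>T *\<^sub>v a) \<bullet> (Sig *\<^sub>v ((P * Z)\<^sup>T *\<^sub>v a))"
      using lam unfolding PZT[OF a] by (simp add: k_def y_def)
  next
    fix a :: "real vec" assume a: "a \<in> carrier_vec m" "(P * Z)\<^sup>T *\<^sub>v a = 0\<^sub>v n"
    have Pa: "P\<^sup>T *\<^sub>v a \<in> carrier_vec n" using P a by auto
    have "Z\<^sup>T *\<^sub>v (P\<^sup>T *\<^sub>v a) = 0\<^sub>v n" using PZT[OF a(1)] a(2) by simp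
    moreover have "Z\<^sup>T \<in> carrier_mat n n" "det (Z\<^sup>T) \<noteq> 0" using Z det det_transpose[OF Z] by (auto simp: Z_def)
    ultimately have "P\<^sup>T *\<^sub>v a = 0\<^sub>v n" using det_0_iff_vec_prod_zero[of "Z\<^sup>T" n] Pa by blast
    moreover have "P *\<^sub>v (P\<^sup>T *\<^sub>v a) = a"
      using assoc_mult_mat_vec[of P m n "P\<^sup>T" m a] P PP a by simp
    moreover have "P *\<^sub>v (0\<^sub>v n) = 0\<^sub>v m" using P by (intro eq_vecI) auto
    ultimately show "a = 0\<^sub>v m" by simp
  qed
  then obtain z where z: "z \<in> ellipsoid n Sig" "(P * Z) *\<^sub>v z = p" by blast
  then have "P *\<^sub>v (Z *\<^sub>v z) = p" using P Z by (simp add: ellipsoid_def assoc_mult_mat_vec[of _ m n _ n])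
  then show ?thesis using z unfolding Z_def by blast
qed

section \<open>Concentration of a random vector on its support\<close>

lemma space_vec_borel [simp]: "space (vec_borel n) = carrier_vec n"
  by (simp add: vec_borel_def)

lemma vec_borel_component_measurable [measurable]:
  assumes "i < n"
  shows "(\<lambda>x. x $ i) \<in> borel_measurable (vec_borel n)"
proof -
  have "(\<lambda>x. (\<lambda>i\<in>{..<n}. x $ i)) \<in> vec_borel n \<rightarrow>\<^sub>M PiM {..<n} (\<lambda>_. borel :: real measure)"
    unfolding vec_borel_def by (rule measurable_vimage_algebra1) (auto simp: space_PiM)
  from measurable_compose[OF this measurable_component_singleton, of i] assms
  show ?thesis by simp
qed

lemma vec_ball_in_sets:
  assumes z: "z \<in> carrier_vec n"
  shows "{y \<in> carrier_vec n. norm2 (y - z) < e} \<in> sets (vec_borel n)"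
proof -
  have "norm2 (y - z) = sqrt (\<Sum>i<n. (y $ i - z $ i) * (y $ i - z $ i))" if "y \<in> carrier_vec n" for y
    using that z by (simp add: norm2_def scalar_prod_def atLeast0LessThan)
  then have eq: "{y \<in> carrier_vec n. norm2 (y - z) < e}
      = {y \<in> space (vec_borel n). sqrt (\<Sum>i<n. (y $ i - z $ i) * (y $ i - z $ i)) < e}"
    by auto
  have m: "(\<lambda>y. \<Sum>i<n. (y $ i - z $ i) * (y $ i - z $ i)) \<in> borel_measurable (vec_borel n)"
    by (intro borel_measurable_sum borel_measurable_times borel_measurable_diff
        vec_borel_component_measurable borel_measurable_const) auto
  show ?thesis unfolding eq using m by measurable
qed

lemma rational_vec_dense:
  assumes z: "z \<in> carrier_vec n" and e: "0 < e"
  shows "\<exists>q\<in>vec n ` ({..<n} \<rightarrow>\<^sub>E \<rat>). norm2 (z - q) < e"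
proof -
  \<comment> \<open>dividing by \<open>n + 1\<close> makes the sum of the coordinate errors strictly less than \<open>e\<close>\<close>
  have "\<exists>q\<in>\<rat>. \<bar>z $ i - q\<bar> < e / (n + 1)" for i
  proof -
    obtain q where "q \<in> \<rat>" "z $ i < q" "q < z $ i + e / (n + 1)"
      using Rats_dense_in_real[of "z $ i" "z $ i + e / (n + 1)"] e by auto
    then show ?thesis by (intro bexI[of _ q]) auto
  qed
  then obtain f where f: "\<And>i. f i \<in> \<rat>" "\<And>i. \<bar>z $ i - f i\<bar> < e / (n + 1)" by metis
  let ?q = "vec n (restrict f {..<n})"
  have "norm2 (z - ?q) \<le> (\<Sum>i<n. \<bar>z $ i - f i\<bar>)"
    using L2_set_le_sum_abs[of "\<lambda>i. (z - ?q) $ i" "{..<n}"] z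
    by (simp add: norm2_L2_set atLeast0LessThan)
  also have "\<dots> \<le> (\<Sum>i<n. e / (n + 1))" by (intro sum_mono less_imp_le f)
  also have "\<dots> < e" using e by (simp add: field_simps)
  finally have "norm2 (z - ?q) < e" .
  moreover have "?q \<in> vec n ` ({..<n} \<rightarrow>\<^sub>E \<rat>)" using f by auto
  ultimately show ?thesis by blast
qed

text \<open>
  Every point outside the support has a null ball around it, and this ball contains a ball with
  rational centre and rational radius that still contains the point. So the complement of the
  support is covered by countably many null balls.
\<close>

lemma AE_vec_support:
  assumes Pr: "prob_space Pr" and X: "X \<in> measurable Pr (vec_borel n)"
  shows "AE \<omega> in Pr. X \<omega> \<in> vec_support n Pr X"
proof (rule AE_distrD[OF X])
  define D where "D = distr Pr (vec_borel n) X"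
  interpret D: prob_space D unfolding D_def by (rule prob_space.prob_space_distr[OF Pr X])
  define ball where "ball z e = {y \<in> carrier_vec n. norm2 (y - z) < e}" for z :: "real vec" and e
  have ball_sets: "ball z e \<in> sets D" if "z \<in> carrier_vec n" for z e
    using vec_ball_in_sets[OF that] by (simp add: ball_def D_def)
  define I where "I = {(q, r). q \<in> vec n ` ({..<n} \<rightarrow>\<^sub>E \<rat>) \<and> r \<in> \<rat> \<and> measure D (ball q r) = 0}"
  have "I \<subseteq> (vec n ` ({..<n} \<rightarrow>\<^sub>E \<rat>)) \<times> \<rat>" by (auto simp: I_def)
  moreover have "countable (vec n ` ({..<n} \<rightarrow>\<^sub>E (\<rat> :: real set)))"
    by (rule countable_image, rule countable_PiE) (simp_all add: countable_rat)
  ultimately have "countable I"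
    by (meson countable_SIGMA countable_rat countable_subset)
  moreover have "(case p of (q, r) \<Rightarrow> ball q r) \<in> null_sets D" if "p \<in> I" for p
    using that ball_sets by (auto simp: I_def null_sets_def D.emeasure_eq_measure)
  ultimately have "(\<Union>p\<in>I. case p of (q, r) \<Rightarrow> ball q r) \<in> null_sets D"
    by (rule null_sets_UN')
  from AE_not_in[OF this] have "AE y in D. y \<in> vec_support n Pr X"
  proof (rule AE_mp, intro AE_I2 impI)
    fix z assume "z \<in> space D" and notin: "z \<notin> (\<Union>p\<in>I. case p of (q, r) \<Rightarrow> ball q r)"
    then have z: "z \<in> carrier_vec n" by (simp add: D_def)
    have "0 < measure D (ball z e)" if e: "0 < e" for e
    proof (rule ccontr)
      assume "\<not> 0 < measure D (ball z e)"
      then have null: "measure D (ball z e) = 0" using measure_nonneg[of D "ball z e"] by linarith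
      obtain q where q: "q \<in> vec n ` ({..<n} \<rightarrow>\<^sub>E \<rat>)" "norm2 (z - q) < e / 2"
        using rational_vec_dense[OF z half_gt_zero[OF e]] by blast
      obtain r where r: "r \<in> \<rat>" "norm2 (z - q) < r" "r < e / 2"
        using Rats_dense_in_real[OF q(2)] by blast
      have qc: "q \<in> carrier_vec n" using q(1) by (metis imageE vec_carrier)
      have "ball q r \<subseteq> ball z e"
      proof
        fix y assume y: "y \<in> ball q r"
        then have yc: "y \<in> carrier_vec n" by (simp add: ball_def)
        have "y - z = (y - q) + (q - z)" using yc qc z by (intro eq_vecI) auto
        then have "norm2 (y - z) \<le> norm2 (y - q) + norm2 (q - z)"
          using norm2_triangle[of "y - q" n "q - z"] yc qc z by simp
        also have "q - z = (- 1) \<cdot>\<^sub>v (z - q)" using qc z by (intro eq_vecI) auto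
        also have "norm2 \<dots> = norm2 (z - q)" by (simp add: norm2_smult)
        finally have "norm2 (y - z) < e" using y r by (simp add: ball_def)
        then show "y \<in> ball z e" using yc by (simp add: ball_def)
      qed
      then have "measure D (ball q r) \<le> measure D (ball z e)"
        using ball_sets[OF z] by (intro D.finite_measure_mono)
      then have "measure D (ball q r) = 0" using null measure_nonneg[of D "ball q r"] by linarith
      then have "(q, r) \<in> I" using q r by (auto simp: I_def)
      moreover have "z \<in> ball q r" using z r by (simp add: ball_def)
      ultimately show False using notin by auto
    qed
    then show "z \<in> vec_support n Pr X" using z by (simp add: vec_support_def D_def ball_def)
  qed
  then show "AE y in distr Pr (vec_borel n) X. y \<in> vec_support n Pr X" unfolding D_def .
qed

lemma ellipsoid_bounded:
  assumes Sig: "pos_def n Sig" and i: "i < n"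
  obtains b where "\<And>z. z \<in> ellipsoid n Sig \<Longrightarrow> \<bar>z $ i\<bar> \<le> b"
proof (rule that)
  fix z assume z: "z \<in> ellipsoid n Sig"
  then have "unit_vec n i \<bullet> z = z $ i" using i by (auto simp: ellipsoid_def)
  then show "\<bar>z $ i\<bar> \<le> norm2 (psd_sqrt n Sig *\<^sub>v unit_vec n i)"
    using ellipsoid_scalar_prod_le[OF Sig _ z, of "unit_vec n i"] by simp
qed

section \<open>Expectation of quadratic forms\<close>

lemma has_bochner_integral_linear:
  assumes X: "\<And>\<omega>. \<omega> \<in> space Pr \<Longrightarrow> X \<omega> \<in> carrier_vec n" and v: "v \<in> carrier_vec n"
    and mean: "\<And>i. i < n \<Longrightarrow> has_bochner_integral Pr (\<lambda>\<omega>. X \<omega> $ i) (0 :: real)"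
  shows "has_bochner_integral Pr (\<lambda>\<omega>. v \<bullet> X \<omega>) 0"
proof -
  have "has_bochner_integral Pr (\<lambda>\<omega>. \<Sum>i<n. v $ i * X \<omega> $ i) (\<Sum>i<n. v $ i * 0)"
    by (intro has_bochner_integral_sum has_bochner_integral_mult_right mean) auto
  moreover have "v \<bullet> X \<omega> = (\<Sum>i<n. v $ i * X \<omega> $ i)" if "\<omega> \<in> space Pr" for \<omega>
    using X[OF that] by (simp add: scalar_prod_def atLeast0LessThan)
  ultimately show ?thesis by (simp cong: has_bochner_integral_cong)
qed

lemma has_bochner_integral_bilinear:
  fixes A :: "real mat"
  assumes A: "A \<in> carrier_mat n m"
    and X: "\<And>\<omega>. \<omega> \<in> space Pr \<Longrightarrow> X \<omega> \<in> carrier_vec n"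
    and Y: "\<And>\<omega>. \<omega> \<in> space Pr \<Longrightarrow> Y \<omega> \<in> carrier_vec m"
    and mom: "\<And>i j. i < n \<Longrightarrow> j < m \<Longrightarrow> has_bochner_integral Pr (\<lambda>\<omega>. X \<omega> $ i * Y \<omega> $ j) (M i j)"
  shows "has_bochner_integral Pr (\<lambda>\<omega>. X \<omega> \<bullet> (A *\<^sub>v Y \<omega>)) (\<Sum>i<n. \<Sum>j<m. A $$ (i, j) * M i j)"
proof -
  have "has_bochner_integral Pr (\<lambda>\<omega>. \<Sum>i<n. \<Sum>j<m. A $$ (i, j) * (X \<omega> $ i * Y \<omega> $ j))
      (\<Sum>i<n. \<Sum>j<m. A $$ (i, j) * M i j)"
    by (intro has_bochner_integral_sum has_bochner_integral_mult_right mom) auto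
  moreover have "X \<omega> \<bullet> (A *\<^sub>v Y \<omega>) = (\<Sum>i<n. \<Sum>j<m. A $$ (i, j) * (X \<omega> $ i * Y \<omega> $ j))"
    if "\<omega> \<in> space Pr" for \<omega> by (rule quad_form_sum[OF A X[OF that] Y[OF that]])
  ultimately show ?thesis by (simp cong: has_bochner_integral_cong)
qed

lemma congruence_form:
  fixes R :: "real mat"
  assumes R: "R \<in> carrier_mat k k" and P: "P \<in> carrier_mat k n" and Q: "Q \<in> carrier_mat k m"
    and x: "x \<in> carrier_vec n" and y: "y \<in> carrier_vec m"
  shows "(P *\<^sub>v x) \<bullet> (R *\<^sub>v (Q *\<^sub>v y)) = x \<bullet> ((P\<^sup>T * R * Q) *\<^sub>v y)"
proof -
  have RQy: "R *\<^sub>v (Q *\<^sub>v y) \<in> carrier_vec k" using R Q y by auto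
  have "(P\<^sup>T * R * Q) *\<^sub>v y = (P\<^sup>T * R) *\<^sub>v (Q *\<^sub>v y)"
    by (rule assoc_mult_mat_vec) (use P R Q y in auto)
  also have "\<dots> = P\<^sup>T *\<^sub>v (R *\<^sub>v (Q *\<^sub>v y))" by (rule assoc_mult_mat_vec) (use P R Q y in auto)
  finally show ?thesis
    using scalar_prod_transpose[of "P\<^sup>T" n k x "R *\<^sub>v (Q *\<^sub>v y)"] P x RQy
      comm_scalar_prod[of "P *\<^sub>v x" k "R *\<^sub>v (Q *\<^sub>v y)"] by auto
qed

lemma tr_mult_sum:
  assumes "A \<in> carrier_mat n n" "B \<in> carrier_mat n n" "\<And>i j. i < n \<Longrightarrow> j < n \<Longrightarrow> B $$ (j, i) = M i j"
  shows "tr (A * B) = (\<Sum>i<n. \<Sum>j<n. A $$ (i, j) * M i j)"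
  using assms by (simp add: tr_def scalar_prod_def atLeast0LessThan)

text \<open>
  Expanding the quadratic form, the linear terms vanish because the means do, and the mixed term
  because \<open>X\<close> and \<open>Y\<close> are uncorrelated.
\<close>

lemma has_bochner_integral_affine_quadratic:
  fixes R :: "real mat"
  assumes Pr: "prob_space Pr"
    and X: "\<And>\<omega>. \<omega> \<in> space Pr \<Longrightarrow> X \<omega> \<in> carrier_vec n"
    and Y: "\<And>\<omega>. \<omega> \<in> space Pr \<Longrightarrow> Y \<omega> \<in> carrier_vec n"
    and mean: "\<And>i. i < n \<Longrightarrow> has_bochner_integral Pr (\<lambda>\<omega>. X \<omega> $ i) 0"
      "\<And>i. i < n \<Longrightarrow> has_bochner_integral Pr (\<lambda>\<omega>. Y \<omega> $ i) 0"
    and mom: "\<And>i j. i < n \<Longrightarrow> j < n \<Longrightarrow> has_bochner_integral Pr (\<lambda>\<omega>. X \<omega> $ i * X \<omega> $ j) (M $$ (i, j))"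
      "\<And>i j. i < n \<Longrightarrow> j < n \<Longrightarrow> has_bochner_integral Pr (\<lambda>\<omega>. Y \<omega> $ i * Y \<omega> $ j) (M $$ (i, j))"
      "\<And>i j. i < n \<Longrightarrow> j < n \<Longrightarrow> has_bochner_integral Pr (\<lambda>\<omega>. X \<omega> $ i * Y \<omega> $ j) 0"
    and M: "M \<in> carrier_mat n n" "M\<^sup>T = M"
    and R: "R \<in> carrier_mat k k" "R\<^sup>T = R"
    and P: "P \<in> carrier_mat k n" and Q: "Q \<in> carrier_mat k n" and c: "c \<in> carrier_vec k"
  shows "has_bochner_integral Pr
      (\<lambda>\<omega>. (c + P *\<^sub>v X \<omega> + Q *\<^sub>v Y \<omega>) \<bullet> (R *\<^sub>v (c + P *\<^sub>v X \<omega> + Q *\<^sub>v Y \<omega>)))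
      (c \<bullet> (R *\<^sub>v c) + tr (P\<^sup>T * R * P * M) + tr (Q\<^sup>T * R * Q * M))"
proof -
  interpret prob_space Pr by (rule Pr)
  define f where "f = (\<lambda>\<omega>. c \<bullet> (R *\<^sub>v c) + X \<omega> \<bullet> ((P\<^sup>T * R * P) *\<^sub>v X \<omega>) + Y \<omega> \<bullet> ((Q\<^sup>T * R * Q) *\<^sub>v Y \<omega>)
      + (2 * ((P\<^sup>T *\<^sub>v (R *\<^sub>v c)) \<bullet> X \<omega>) + 2 * ((Q\<^sup>T *\<^sub>v (R *\<^sub>v c)) \<bullet> Y \<omega>)
      + 2 * (X \<omega> \<bullet> ((P\<^sup>T * R * Q) *\<^sub>v Y \<omega>))))"
  have expand: "(c + P *\<^sub>v X \<omega> + Q *\<^sub>v Y \<omega>) \<bullet> (R *\<^sub>v (c + P *\<^sub>v X \<omega> + Q *\<^sub>v Y \<omega>)) = f \<omega>"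
    if \<omega>: "\<omega> \<in> space Pr" for \<omega>
  proof -
    define p where "p = P *\<^sub>v X \<omega>"
    define q where "q = Q *\<^sub>v Y \<omega>"
    have p: "p \<in> carrier_vec k" and q: "q \<in> carrier_vec k" using P Q X[OF \<omega>] Y[OF \<omega>] by (auto simp: p_def q_def)
    have Rs: "R *\<^sub>v c \<in> carrier_vec k" "R *\<^sub>v p \<in> carrier_vec k" "R *\<^sub>v q \<in> carrier_vec k"
      using R c p q by auto
    have sym: "x \<bullet> (R *\<^sub>v y) = y \<bullet> (R *\<^sub>v x)" if "x \<in> carrier_vec k" "y \<in> carrier_vec k" for x y
      using scalar_prod_transpose[OF R(1) that] R(2) by simp
    have "R *\<^sub>v (c + p + q) = R *\<^sub>v c + R *\<^sub>v p + R *\<^sub>v q"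
      using R(1) c p q mult_add_distrib_mat_vec[OF R(1), of "c + p" q] mult_add_distrib_mat_vec[OF R(1) c p]
      by simp
    then have "(c + p + q) \<bullet> (R *\<^sub>v (c + p + q))
        = c \<bullet> (R *\<^sub>v c) + p \<bullet> (R *\<^sub>v p) + q \<bullet> (R *\<^sub>v q)
          + (2 * (p \<bullet> (R *\<^sub>v c)) + 2 * (q \<bullet> (R *\<^sub>v c)) + 2 * (p \<bullet> (R *\<^sub>v q)))"
      using c p q Rs sym[OF c p] sym[OF c q] sym[OF q p]
      by (simp add: add_scalar_prod_distrib[of _ k] scalar_prod_add_distrib[of _ k])
    moreover have "p \<bullet> (R *\<^sub>v p) = X \<omega> \<bullet> ((P\<^sup>T * R * P) *\<^sub>v X \<omega>)"
      "q \<bullet> (R *\<^sub>v q) = Y \<omega> \<bullet> ((Q\<^sup>T * R * Q) *\<^sub>v Y \<omega>)"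
      "p \<bullet> (R *\<^sub>v q) = X \<omega> \<bullet> ((P\<^sup>T * R * Q) *\<^sub>v Y \<omega>)"
      unfolding p_def q_def using congruence_form[OF R(1)] P Q X[OF \<omega>] Y[OF \<omega>] by blast+
    moreover have "p \<bullet> (R *\<^sub>v c) = (P\<^sup>T *\<^sub>v (R *\<^sub>v c)) \<bullet> X \<omega>"
      "q \<bullet> (R *\<^sub>v c) = (Q\<^sup>T *\<^sub>v (R *\<^sub>v c)) \<bullet> Y \<omega>"
      using transpose_vec_mult_scalar[OF P X[OF \<omega>] Rs(1)] transpose_vec_mult_scalar[OF Q Y[OF \<omega>] Rs(1)]
        comm_scalar_prod[OF p Rs(1)] comm_scalar_prod[OF q Rs(1)] by (simp_all add: p_def q_def)
    ultimately show ?thesis by (simp add: f_def p_def[symmetric] q_def[symmetric])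
  qed
  have Mij: "M $$ (j, i) = M $$ (i, j)" if "i < n" "j < n" for i j
    using M that by (metis carrier_matD index_transpose_mat(1))
  have PRP: "P\<^sup>T * R * P \<in> carrier_mat n n" and QRQ: "Q\<^sup>T * R * Q \<in> carrier_mat n n"
    and PRQ: "P\<^sup>T * R * Q \<in> carrier_mat n n" using P Q R by auto
  have Rc: "R *\<^sub>v c \<in> carrier_vec k" using R c by auto
  have lin: "P\<^sup>T *\<^sub>v (R *\<^sub>v c) \<in> carrier_vec n" "Q\<^sup>T *\<^sub>v (R *\<^sub>v c) \<in> carrier_vec n" using P Q Rc by auto
  have const: "has_bochner_integral Pr (\<lambda>\<omega>. c \<bullet> (R *\<^sub>v c)) (c \<bullet> (R *\<^sub>v c))"
    by (simp add: has_bochner_integral_iff prob_space)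
  have XX: "has_bochner_integral Pr (\<lambda>\<omega>. X \<omega> \<bullet> ((P\<^sup>T * R * P) *\<^sub>v X \<omega>)) (tr (P\<^sup>T * R * P * M))"
    using has_bochner_integral_bilinear[OF PRP X X mom(1)]
      tr_mult_sum[OF PRP M(1), where M="\<lambda>i j. M $$ (i, j)"] Mij by simp
  have YY: "has_bochner_integral Pr (\<lambda>\<omega>. Y \<omega> \<bullet> ((Q\<^sup>T * R * Q) *\<^sub>v Y \<omega>)) (tr (Q\<^sup>T * R * Q * M))"
    using has_bochner_integral_bilinear[OF QRQ Y Y mom(2)]
      tr_mult_sum[OF QRQ M(1), where M="\<lambda>i j. M $$ (i, j)"] Mij by simp
  have XY: "has_bochner_integral Pr (\<lambda>\<omega>. X \<omega> \<bullet> ((P\<^sup>T * R * Q) *\<^sub>v Y \<omega>)) 0"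
    using has_bochner_integral_bilinear[OF PRQ X Y mom(3)] by simp
  have "has_bochner_integral Pr f (c \<bullet> (R *\<^sub>v c) + tr (P\<^sup>T * R * P * M) + tr (Q\<^sup>T * R * Q * M)
      + (2 * 0 + 2 * 0 + 2 * 0))"
    unfolding f_def
    by (intro has_bochner_integral_add has_bochner_integral_mult_right const XX YY XY
        has_bochner_integral_linear[OF X lin(1) mean(1)] has_bochner_integral_linear[OF Y lin(2) mean(2)])
  then show ?thesis using expand by (simp cong: has_bochner_integral_cong)
qed

section \<open>Feasibility of the recovered policy and contract\<close>

text \<open>
  Closing the loop: the coefficients on the right are those that the semidefinite program calls
  \<open>xbar\<close>, \<open>Pw\<close> and \<open>P\<xi>\<close>.
\<close>

lemma surrogate_affine:
  assumes mats: "surrogate_matrices S Bt Lt Ht"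
    and carr: "Qw \<in> carrier_mat (Nu S) (Nx S)" "Qx \<in> carrier_mat (Nu S) (Nx S)"
      "Z \<in> carrier_mat (Nx S) (Nx S)" "ubar \<in> carrier_vec (Nu S)" "vbar \<in> carrier_vec (Nx S)"
    and w: "w \<in> carrier_vec (Nx S)" and z: "z \<in> carrier_vec (Nx S)"
  shows "surrogate_state S Bt Lt Ht (ubar + Qw *\<^sub>v w + Qx *\<^sub>v z) w (vbar + Z *\<^sub>v z)
    = (Bt *\<^sub>v ubar + Ht *\<^sub>v (PiC S *\<^sub>v vbar)) + (Bt * Qw + Lt) *\<^sub>v w + (Bt * Qx + Ht * (PiC S * Z)) *\<^sub>v z"
proof -
  have B: "Bt \<in> carrier_mat (Nx S) (Nu S)" and L: "Lt \<in> carrier_mat (Nx S) (Nx S)"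
    and H: "Ht \<in> carrier_mat (Nx S) (NxC S)" using mats by (auto simp: surrogate_matrices_def)
  note P = PiC_carrier[of S]
  have PZ: "PiC S * Z \<in> carrier_mat (NxC S) (Nx S)" using P carr by auto
  have vecs: "Qw *\<^sub>v w \<in> carrier_vec (Nu S)" "Qx *\<^sub>v z \<in> carrier_vec (Nu S)"
    "Z *\<^sub>v z \<in> carrier_vec (Nx S)" "PiC S *\<^sub>v vbar \<in> carrier_vec (NxC S)"
    "PiC S *\<^sub>v (Z *\<^sub>v z) \<in> carrier_vec (NxC S)"
    using carr w z P by auto
  have "Bt *\<^sub>v (ubar + Qw *\<^sub>v w + Qx *\<^sub>v z) = Bt *\<^sub>v ubar + Bt *\<^sub>v (Qw *\<^sub>v w) + Bt *\<^sub>v (Qx *\<^sub>v z)"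
    using mult_add_distrib_mat_vec[OF B, of "ubar + Qw *\<^sub>v w" "Qx *\<^sub>v z"]
      mult_add_distrib_mat_vec[OF B carr(4) vecs(1)] carr vecs by simp
  moreover have "PiC S *\<^sub>v (vbar + Z *\<^sub>v z) = PiC S *\<^sub>v vbar + PiC S *\<^sub>v (Z *\<^sub>v z)"
    by (rule mult_add_distrib_mat_vec[OF P carr(5) vecs(3)])
  moreover have "Ht *\<^sub>v (PiC S *\<^sub>v vbar + PiC S *\<^sub>v (Z *\<^sub>v z))
      = Ht *\<^sub>v (PiC S *\<^sub>v vbar) + Ht *\<^sub>v (PiC S *\<^sub>v (Z *\<^sub>v z))"
    by (rule mult_add_distrib_mat_vec[OF H vecs(4,5)])
  moreover have "(Bt * Qw + Lt) *\<^sub>v w = Bt *\<^sub>v (Qw *\<^sub>v w) + Lt *\<^sub>v w"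
    using add_mult_distrib_mat_vec[of "Bt * Qw" "Nx S" "Nx S" Lt w] assoc_mult_mat_vec[OF B carr(1) w]
      B carr(1) L w by simp
  moreover have "(Bt * Qx + Ht * (PiC S * Z)) *\<^sub>v z
      = Bt *\<^sub>v (Qx *\<^sub>v z) + Ht *\<^sub>v (PiC S *\<^sub>v (Z *\<^sub>v z))"
    using add_mult_distrib_mat_vec[of "Bt * Qx" "Nx S" "Nx S" "Ht * (PiC S * Z)" z]
      assoc_mult_mat_vec[OF B carr(2) z] assoc_mult_mat_vec[OF H PZ z] assoc_mult_mat_vec[OF P carr(3) z]
      B H PZ carr(2) z by (simp del: assoc_mult_mat)
  moreover have rearrange: "(a + b + c) + d + (e + f) = (a + e) + (b + d) + (c + f)"
    if "a \<in> carrier_vec k" "b \<in> carrier_vec k" "c \<in> carrier_vec k" "d \<in> carrier_vec k"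
      "e \<in> carrier_vec k" "f \<in> carrier_vec k" for a b c d e f :: "real vec" and k
    using that by (intro eq_vecI) auto
  ultimately show ?thesis
    unfolding surrogate_state_def
    by (simp only:) (rule rearrange[of _ "Nx S"], use B L H carr vecs w z in auto)
qed

text \<open>
  Testing the linear matrix inequality on the stacked vector \<open>(-a, w, z)\<close> gives, for every \<open>a\<close>, a
  bound on \<open>a \<bullet> p\<close> with \<open>p\<close> the projected deviation. The weights \<open>\<beta>\<close> and \<open>lam - \<beta>\<close> of the
  two quadratic forms, each at most \<open>1\<close>, add up to \<open>lam\<close>.
\<close>

lemma contract_constraint_satisfied:
  assumes S: "netsys_ok S" and Sig: "pos_def (Nx S) Sig" and Y: "Y \<in> YC S"
    and Pw: "Pw \<in> carrier_mat (Nx S) (Nx S)" and Px: "Px \<in> carrier_mat (Nx S) (Nx S)"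
    and lam: "0 < lam" "0 \<le> \<beta>" "\<beta> \<le> lam"
    and lmi: "psd (NxC S + (Nx S + Nx S)) (S_lmi S Sig Y Pw Px lam \<beta>)"
    and w: "w \<in> ellipsoid (Nx S) Sig" and z: "z \<in> ellipsoid (Nx S) Sig"
  shows "\<exists>y\<in>ellipsoid (Nx S) Sig.
    PiC S *\<^sub>v ((lam \<cdot>\<^sub>m 1\<^sub>m (Nx S) - Y) *\<^sub>v y) = PiC S *\<^sub>v (Pw *\<^sub>v w + Px *\<^sub>v z)"
proof -
  let ?n = "Nx S" and ?m = "NxC S" and ?P = "PiC S"
  define T where "T = lam \<cdot>\<^sub>m Sig - Y * Sig - Sig * Y\<^sup>T"
  have Yc: "Y \<in> carrier_mat ?n ?n" using Y by (simp add: YC_def)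
  have Sc: "Sig \<in> carrier_mat ?n ?n" using Sig by (auto simp: pos_def_def)
  have T: "T \<in> carrier_mat ?n ?n" using Yc Sc by (auto simp: T_def)
  note P = PiC_carrier[of S]
  note Si = pos_def_minv(1)[OF Sig]
  have wc: "w \<in> carrier_vec ?n" "w \<bullet> (minv Sig *\<^sub>v w) \<le> 1" using w by (auto simp: ellipsoid_def)
  have zc: "z \<in> carrier_vec ?n" "z \<bullet> (minv Sig *\<^sub>v z) \<le> 1" using z by (auto simp: ellipsoid_def)
  define p where "p = ?P *\<^sub>v (Pw *\<^sub>v w + Px *\<^sub>v z)"
  have Pwx: "Pw *\<^sub>v w \<in> carrier_vec ?n" "Px *\<^sub>v z \<in> carrier_vec ?n" using Pw Px wc zc by auto
  have p: "p \<in> carrier_vec ?m" using P Pwx by (auto simp: p_def)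
  have PTP: "?P * T * ?P\<^sup>T \<in> carrier_mat ?m ?m" using P T by auto
  have PP: "?P * Pw \<in> carrier_mat ?m ?n" "?P * Px \<in> carrier_mat ?m ?n" using P Pw Px by auto
  have D: "\<beta> \<cdot>\<^sub>m minv Sig \<in> carrier_mat ?n ?n" "(lam - \<beta>) \<cdot>\<^sub>m minv Sig \<in> carrier_mat ?n ?n" using Si by auto
  have blocks: "psd (?m + (?n + ?n)) (four_block_mat (?P * T * ?P\<^sup>T) (append_cols (?P * Pw) (?P * Px))
      ((?P * Pw)\<^sup>T @\<^sub>r (?P * Px)\<^sup>T)
      (four_block_mat (\<beta> \<cdot>\<^sub>m minv Sig) (0\<^sub>m ?n ?n) (0\<^sub>m ?n ?n) ((lam - \<beta>) \<cdot>\<^sub>m minv Sig)))"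
    using lmi unfolding S_lmi_def Let_def T_def transpose_mult[OF P Pw] transpose_mult[OF P Px] .
  have p_eq: "(?P * Pw) *\<^sub>v w + (?P * Px) *\<^sub>v z = p"
    unfolding p_def mult_add_distrib_mat_vec[OF P Pwx]
    using assoc_mult_mat_vec[OF P Pw wc(1)] assoc_mult_mat_vec[OF P Px zc(1)] by simp
  have scaled: "x \<bullet> ((c \<cdot>\<^sub>m minv Sig) *\<^sub>v x) = c * (x \<bullet> (minv Sig *\<^sub>v x))" if "x \<in> carrier_vec ?n" for x c
  proof -
    have "(c \<cdot>\<^sub>m minv Sig) *\<^sub>v x = c \<cdot>\<^sub>v (minv Sig *\<^sub>v x)" using Si that by (intro eq_vecI) auto
    then show ?thesis using Si that by simp
  qed
  have "2 * (a \<bullet> p) \<le> lam + a \<bullet> ((?P * T * ?P\<^sup>T) *\<^sub>v a)" if a: "a \<in> carrier_vec ?m" for a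
  proof -
    have na: "- 1 \<cdot>\<^sub>v a \<in> carrier_vec ?m" using a by auto
    have "0 \<le> (- 1 \<cdot>\<^sub>v a) \<bullet> ((?P * T * ?P\<^sup>T) *\<^sub>v (- 1 \<cdot>\<^sub>v a)) + 2 * ((- 1 \<cdot>\<^sub>v a) \<bullet> p)
        + \<beta> * (w \<bullet> (minv Sig *\<^sub>v w)) + (lam - \<beta>) * (z \<bullet> (minv Sig *\<^sub>v z))"
      using block_psd_form[OF PTP PP D blocks na wc(1) zc(1)]
      unfolding p_eq scaled[OF wc(1)] scaled[OF zc(1)] .
    also have "(- 1 \<cdot>\<^sub>v a) \<bullet> ((?P * T * ?P\<^sup>T) *\<^sub>v (- 1 \<cdot>\<^sub>v a)) = a \<bullet> ((?P * T * ?P\<^sup>T) *\<^sub>v a)"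
    proof -
      have "(?P * T * ?P\<^sup>T) *\<^sub>v a \<in> carrier_vec ?m" using PTP a by auto
      then show ?thesis unfolding mult_mat_vec[OF PTP a] using a by simp
    qed
    also have "(- 1 \<cdot>\<^sub>v a) \<bullet> p = - (a \<bullet> p)" using a p by simp
    finally show ?thesis
      using mult_left_mono[OF wc(2) lam(2)] mult_left_mono[OF zc(2), of "lam - \<beta>"] lam by simp
  qed
  then show ?thesis
    unfolding p_def[symmetric]
    by (intro projected_contract_member[OF Sig Yc lam(1) P PiC_mult_transpose[OF S] p
          contract_matrix_invertible(2)[OF Y lam(1)]]) (simp add: T_def)
qed

lemma robust_row:
  assumes Sig: "pos_def n Sig" and G: "G \<in> carrier_mat m n" and i: "i < m" and z: "z \<in> ellipsoid n Sig"
  shows "(G *\<^sub>v z) $ i \<le> norm2 (psd_sqrt n Sig *\<^sub>v (G\<^sup>T *\<^sub>v unit_vec m i))"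
proof -
  have zc: "z \<in> carrier_vec n" using z by (simp add: ellipsoid_def)
  have "(G *\<^sub>v z) $ i = unit_vec m i \<bullet> (G *\<^sub>v z)" using G i zc by simp
  also have "\<dots> = (G\<^sup>T *\<^sub>v unit_vec m i) \<bullet> z"
    using transpose_vec_mult_scalar[OF G zc, of "unit_vec m i"] by simp
  also have "\<dots> \<le> norm2 (psd_sqrt n Sig *\<^sub>v (G\<^sup>T *\<^sub>v unit_vec m i))"
    using ellipsoid_scalar_prod_le[OF Sig _ z, of "G\<^sup>T *\<^sub>v unit_vec m i"] G by auto
  finally show ?thesis .
qed

lemma operational_constraint_satisfied:
  assumes Sig: "pos_def n Sig"
    and F: "F1 \<in> carrier_mat m n" "F2 \<in> carrier_mat m k" "F3 \<in> carrier_mat m n" and g: "g \<in> carrier_vec m"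
    and P: "Pw \<in> carrier_mat n n" "Px \<in> carrier_mat n n" and Q: "Qw \<in> carrier_mat k n" "Qx \<in> carrier_mat k n"
    and c: "xbar \<in> carrier_vec n" "ubar \<in> carrier_vec k"
    and rows: "\<And>i. i < m \<Longrightarrow>
      norm2 (psd_sqrt n Sig *\<^sub>v ((F1 * Pw + F2 * Qw + F3)\<^sup>T *\<^sub>v unit_vec m i))
      + norm2 (psd_sqrt n Sig *\<^sub>v ((F1 * Px + F2 * Qx)\<^sup>T *\<^sub>v unit_vec m i))
      \<le> unit_vec m i \<bullet> (g - F1 *\<^sub>v xbar - F2 *\<^sub>v ubar)"
    and w: "w \<in> ellipsoid n Sig" and z: "z \<in> ellipsoid n Sig"
  shows "F1 *\<^sub>v (xbar + Pw *\<^sub>v w + Px *\<^sub>v z) + F2 *\<^sub>v (ubar + Qw *\<^sub>v w + Qx *\<^sub>v z) + F3 *\<^sub>v w \<le> g"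
  unfolding less_eq_vec_def
proof (intro conjI allI impI)
  have wc: "w \<in> carrier_vec n" and zc: "z \<in> carrier_vec n" using w z by (auto simp: ellipsoid_def)
  let ?G = "F1 * Pw + F2 * Qw + F3" and ?H = "F1 * Px + F2 * Qx"
  have G: "?G \<in> carrier_mat m n" and H: "?H \<in> carrier_mat m n" using F P Q by auto
  have FP: "F1 * Pw \<in> carrier_mat m n" "F2 * Qw \<in> carrier_mat m n" "F1 * Px \<in> carrier_mat m n"
    "F2 * Qx \<in> carrier_mat m n" using F P Q by auto
  have PQ: "Pw *\<^sub>v w \<in> carrier_vec n" "Px *\<^sub>v z \<in> carrier_vec n" "Qw *\<^sub>v w \<in> carrier_vec k"
    "Qx *\<^sub>v z \<in> carrier_vec k" using P Q wc zc by auto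
  have "?G *\<^sub>v w = F1 *\<^sub>v (Pw *\<^sub>v w) + F2 *\<^sub>v (Qw *\<^sub>v w) + F3 *\<^sub>v w"
    using add_mult_distrib_mat_vec[of "F1 * Pw + F2 * Qw" m n F3 w] add_mult_distrib_mat_vec[OF FP(1,2) wc]
      assoc_mult_mat_vec[OF F(1) P(1) wc] assoc_mult_mat_vec[OF F(2) Q(1) wc] FP F wc by simp
  moreover have "?H *\<^sub>v z = F1 *\<^sub>v (Px *\<^sub>v z) + F2 *\<^sub>v (Qx *\<^sub>v z)"
    using add_mult_distrib_mat_vec[OF FP(3,4) zc]
      assoc_mult_mat_vec[OF F(1) P(2) zc] assoc_mult_mat_vec[OF F(2) Q(2) zc] by simp
  moreover have "F1 *\<^sub>v (xbar + Pw *\<^sub>v w + Px *\<^sub>v z) = F1 *\<^sub>v xbar + F1 *\<^sub>v (Pw *\<^sub>v w) + F1 *\<^sub>v (Px *\<^sub>v z)"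
    using mult_add_distrib_mat_vec[OF F(1), of "xbar + Pw *\<^sub>v w" "Px *\<^sub>v z"]
      mult_add_distrib_mat_vec[OF F(1) c(1) PQ(1)] c PQ by simp
  moreover have "F2 *\<^sub>v (ubar + Qw *\<^sub>v w + Qx *\<^sub>v z) = F2 *\<^sub>v ubar + F2 *\<^sub>v (Qw *\<^sub>v w) + F2 *\<^sub>v (Qx *\<^sub>v z)"
    using mult_add_distrib_mat_vec[OF F(2), of "ubar + Qw *\<^sub>v w" "Qx *\<^sub>v z"]
      mult_add_distrib_mat_vec[OF F(2) c(2) PQ(3)] c PQ by simp
  ultimately have eq: "F1 *\<^sub>v (xbar + Pw *\<^sub>v w + Px *\<^sub>v z) + F2 *\<^sub>v (ubar + Qw *\<^sub>v w + Qx *\<^sub>v z) + F3 *\<^sub>v w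
      = F1 *\<^sub>v xbar + F2 *\<^sub>v ubar + ?G *\<^sub>v w + ?H *\<^sub>v z"
    using F by (intro eq_vecI) (auto simp del: index_mult_mat_vec)
  show "dim_vec (F1 *\<^sub>v (xbar + Pw *\<^sub>v w + Px *\<^sub>v z) + F2 *\<^sub>v (ubar + Qw *\<^sub>v w + Qx *\<^sub>v z) + F3 *\<^sub>v w) = dim_vec g"
    using F g by simp
  fix i assume "i < dim_vec g"
  then have i: "i < m" using g by simp
  have "(F1 *\<^sub>v xbar + F2 *\<^sub>v ubar + ?G *\<^sub>v w + ?H *\<^sub>v z) $ i
      = (F1 *\<^sub>v xbar) $ i + (F2 *\<^sub>v ubar) $ i + (?G *\<^sub>v w) $ i + (?H *\<^sub>v z) $ i"
    using F G H i by (simp del: index_mult_mat_vec)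
  moreover have "unit_vec m i \<bullet> (g - F1 *\<^sub>v xbar - F2 *\<^sub>v ubar) = g $ i - (F1 *\<^sub>v xbar) $ i - (F2 *\<^sub>v ubar) $ i"
  proof -
    have "unit_vec m i \<bullet> (g - F1 *\<^sub>v xbar - F2 *\<^sub>v ubar) = (g - F1 *\<^sub>v xbar - F2 *\<^sub>v ubar) $ i"
      by (rule scalar_prod_left_unit) (use F g c i in auto)
    then show ?thesis using F g i by (simp del: index_mult_mat_vec)
  qed
  ultimately show "(F1 *\<^sub>v (xbar + Pw *\<^sub>v w + Px *\<^sub>v z) + F2 *\<^sub>v (ubar + Qw *\<^sub>v w + Qx *\<^sub>v z) + F3 *\<^sub>v w) $ i \<le> g $ i"
    unfolding eq using rows[OF i] robust_row[OF Sig G i w] robust_row[OF Sig H i z] by linarith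
qed

section \<open>Moments of the disturbance and of its copy\<close>

lemma vec_support_distr_cong:
  assumes "distr Pr (vec_borel n) X = distr Pr (vec_borel n) X'"
  shows "vec_support n Pr X = vec_support n Pr X'"
  using assms by (simp add: vec_support_def)

text \<open>
  The vector lies almost surely in its support, which is bounded.
\<close>

lemma ellipsoidal_support_integrable:
  assumes Pr: "prob_space Pr" and X: "X \<in> measurable Pr (vec_borel n)"
    and Sig: "pos_def n Sig" and supp: "vec_support n Pr X = ellipsoid n Sig"
    and i: "i < n"
  shows "integrable Pr (\<lambda>\<omega>. X \<omega> $ i)" and "j < n \<Longrightarrow> integrable Pr (\<lambda>\<omega>. X \<omega> $ i * X \<omega> $ j)"
proof -
  interpret prob_space Pr by (rule Pr)
  have AE: "AE \<omega> in Pr. X \<omega> \<in> ellipsoid n Sig" using AE_vec_support[OF Pr X] supp by simp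
  have meas: "(\<lambda>\<omega>. X \<omega> $ l) \<in> borel_measurable Pr" if "l < n" for l
    using measurable_compose[OF X vec_borel_component_measurable[OF that]] .
  obtain b where b: "\<And>z. z \<in> ellipsoid n Sig \<Longrightarrow> \<bar>z $ i\<bar> \<le> b" using ellipsoid_bounded[OF Sig i] by blast
  show "integrable Pr (\<lambda>\<omega>. X \<omega> $ i)"
    by (rule integrable_const_bound[of _ b]) (use AE b meas[OF i] in auto)
  assume j: "j < n"
  obtain d where d: "\<And>z. z \<in> ellipsoid n Sig \<Longrightarrow> \<bar>z $ j\<bar> \<le> d" using ellipsoid_bounded[OF Sig j] by blast
  have bd: "\<bar>z $ i * z $ j\<bar> \<le> b * d" if "z \<in> ellipsoid n Sig" for z
    unfolding abs_mult using b[OF that] d[OF that] by (intro mult_mono) auto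
  show "integrable Pr (\<lambda>\<omega>. X \<omega> $ i * X \<omega> $ j)"
    by (rule integrable_const_bound[of _ "b * d"])
      (use AE bd meas[OF i] meas[OF j] in \<open>auto intro: borel_measurable_times\<close>)
qed

lemma iid_copy_moments:
  assumes Pr: "prob_space Pr"
    and X: "X \<in> measurable Pr (vec_borel n)" and X': "X' \<in> measurable Pr (vec_borel n)"
    and Sig: "pos_def n Sig" and supp: "vec_support n Pr X = ellipsoid n Sig"
    and mean: "zero_mean n Pr X"
    and indep: "prob_space.indep_var Pr (vec_borel n) X (vec_borel n) X'"
    and ident: "distr Pr (vec_borel n) X' = distr Pr (vec_borel n) X"
    and i: "i < n"
  shows "has_bochner_integral Pr (\<lambda>\<omega>. X \<omega> $ i) 0" "has_bochner_integral Pr (\<lambda>\<omega>. X' \<omega> $ i) 0"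
    and "j < n \<Longrightarrow> has_bochner_integral Pr (\<lambda>\<omega>. X \<omega> $ i * X \<omega> $ j) (second_moment n Pr X $$ (i, j))"
    and "j < n \<Longrightarrow> has_bochner_integral Pr (\<lambda>\<omega>. X' \<omega> $ i * X' \<omega> $ j) (second_moment n Pr X $$ (i, j))"
    and "j < n \<Longrightarrow> has_bochner_integral Pr (\<lambda>\<omega>. X \<omega> $ i * X' \<omega> $ j) 0"
proof -
  interpret prob_space Pr by (rule Pr)
  have transfer: "(\<integral>\<omega>. f (X' \<omega>) \<partial>Pr) = (\<integral>\<omega>. f (X \<omega>) \<partial>Pr)" if "f \<in> borel_measurable (vec_borel n)"
    for f :: "real vec \<Rightarrow> real"
    using integral_distr[OF X' that] integral_distr[OF X that] ident by simp
  have supp': "vec_support n Pr X' = ellipsoid n Sig" using vec_support_distr_cong[OF ident] supp by simp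
  note int = ellipsoidal_support_integrable[OF Pr X Sig supp]
  note int' = ellipsoidal_support_integrable[OF Pr X' Sig supp']
  have m: "\<And>l. l < n \<Longrightarrow> (\<lambda>x. x $ l) \<in> borel_measurable (vec_borel n)" by (rule vec_borel_component_measurable)
  have mean0: "(\<integral>\<omega>. X \<omega> $ l \<partial>Pr) = 0" if "l < n" for l using mean that by (simp add: zero_mean_def)
  have mean0': "(\<integral>\<omega>. X' \<omega> $ l \<partial>Pr) = 0" if "l < n" for l
    using transfer[OF m[OF that]] mean0[OF that] by simp
  show "has_bochner_integral Pr (\<lambda>\<omega>. X \<omega> $ i) 0" "has_bochner_integral Pr (\<lambda>\<omega>. X' \<omega> $ i) 0"
    using int(1)[OF i] int'(1)[OF i] mean0[OF i] mean0'[OF i] by (simp_all add: has_bochner_integral_iff)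
  assume j: "j < n"
  have M: "second_moment n Pr X $$ (i, j) = (\<integral>\<omega>. X \<omega> $ i * X \<omega> $ j \<partial>Pr)"
    using i j by (simp add: second_moment_def)
  show "has_bochner_integral Pr (\<lambda>\<omega>. X \<omega> $ i * X \<omega> $ j) (second_moment n Pr X $$ (i, j))"
    using int(2)[OF i j] M by (simp add: has_bochner_integral_iff)
  show "has_bochner_integral Pr (\<lambda>\<omega>. X' \<omega> $ i * X' \<omega> $ j) (second_moment n Pr X $$ (i, j))"
    using int'(2)[OF i j] M transfer[OF borel_measurable_times[OF m[OF i] m[OF j]]]
    by (simp add: has_bochner_integral_iff)
  have ind: "indep_var borel (\<lambda>\<omega>. X \<omega> $ i) borel (\<lambda>\<omega>. X' \<omega> $ j)"
    using indep_var_compose[OF indep m[OF i] m[OF j]] by (simp add: o_def)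
  show "has_bochner_integral Pr (\<lambda>\<omega>. X \<omega> $ i * X' \<omega> $ j) 0"
    using indep_var_lebesgue_integral[OF ind int(1)[OF i] int'(1)[OF j]]
      indep_var_integrable[OF ind int(1)[OF i] int'(1)[OF j]] mean0[OF i]
    by (simp add: has_bochner_integral_iff)
qed

lemma second_moment_sym: "(second_moment n Pr X)\<^sup>T = second_moment n Pr X"
  by (rule eq_matI) (auto simp: second_moment_def mult.commute)

section \<open>Conservative approximation by the semidefinite program\<close>

theorem proposition2:
  fixes S :: netsys
    and Bt Lt Ht Sig :: "real mat"
    and Pr :: "'a measure"
    and w \<xi> :: "'a \<Rightarrow> real vec"
    and Qw Q\<xi> Y Pw P\<xi> :: "real mat"
    and ubar vbar xbar :: "real vec"
    and lam \<beta> :: real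
  assumes system: "netsys_ok S"
    and surrogate: "surrogate_matrices S Bt Lt Ht"
    and prob: "prob_space Pr"
    and w_rv: "w \<in> measurable Pr (vec_borel (Nx S))"
    and xi_rv: "\<xi> \<in> measurable Pr (vec_borel (Nx S))"
    and w_mean: "zero_mean (Nx S) Pr w"
    and Sigma: "pos_def (Nx S) Sig"
    and w_support: "vec_support (Nx S) Pr w = ellipsoid (Nx S) Sig"
    and xi_indep: "prob_space.indep_var Pr (vec_borel (Nx S)) w (vec_borel (Nx S)) \<xi>"
    and xi_ident: "distr Pr (vec_borel (Nx S)) \<xi> = distr Pr (vec_borel (Nx S)) w"
    and feasible: "S_feasible S Bt Lt Ht Sig Qw Q\<xi> Y ubar Pw P\<xi> vbar xbar lam \<beta>"
  shows "J_feasible S Bt Lt Ht (vec_support (Nx S) Pr w) (vec_support (Nx S) Pr \<xi>)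
           Qw Q\<xi> (lam \<cdot>\<^sub>m 1\<^sub>m (Nx S) - Y) ubar vbar
       \<and> J_objective S Bt Lt Ht Pr w \<xi> Qw Q\<xi> (lam \<cdot>\<^sub>m 1\<^sub>m (Nx S) - Y) ubar vbar
         = S_objective S (second_moment (Nx S) Pr w) Qw Q\<xi> ubar Pw P\<xi> xbar"
proof
  let ?n = "Nx S"
  define Z where "Z = lam \<cdot>\<^sub>m 1\<^sub>m ?n - Y"
  have QN: "Qw \<in> QN S" and QC: "Q\<xi> \<in> QC S" and Y: "Y \<in> YC S" and ubar: "ubar \<in> carrier_vec (Nu S)"
    and Pw: "Pw \<in> carrier_mat ?n ?n" and P\<xi>: "P\<xi> \<in> carrier_mat ?n ?n"
    and vbar: "vbar \<in> carrier_vec ?n" and xbar: "xbar \<in> carrier_vec ?n"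
    and lam: "0 < lam" "0 \<le> \<beta>" "\<beta> \<le> lam"
    and xbar_eq: "xbar = Bt *\<^sub>v ubar + Ht *\<^sub>v (PiC S *\<^sub>v vbar)"
    and Pw_eq: "Pw = Bt * Qw + Lt" and P\<xi>_eq: "P\<xi> = Bt * Q\<xi> + Ht * (PiC S * Z)"
    and nominal: "PiC S *\<^sub>v (xbar - vbar) = 0\<^sub>v (NxC S)"
    and lmi: "psd (NxC S + (?n + ?n)) (S_lmi S Sig Y Pw P\<xi> lam \<beta>)"
    using feasible by (auto simp: S_feasible_def Z_def)
  have rows: "norm2 (psd_sqrt ?n Sig *\<^sub>v ((Fx S * Pw + Fu S * Qw + Fw S)\<^sup>T *\<^sub>v unit_vec (ncon S) i))
      + norm2 (psd_sqrt ?n Sig *\<^sub>v ((Fx S * P\<xi> + Fu S * Q\<xi>)\<^sup>T *\<^sub>v unit_vec (ncon S) i))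
      \<le> unit_vec (ncon S) i \<bullet> (gvec S - Fx S *\<^sub>v xbar - Fu S *\<^sub>v ubar)" if "i < ncon S" for i
    using feasible that unfolding S_feasible_def by blast
  have Qw: "Qw \<in> carrier_mat (Nu S) ?n" and Q\<xi>: "Q\<xi> \<in> carrier_mat (Nu S) ?n"
    using QN QC by (auto simp: QN_def QC_def causal_space_def)
  have Zc: "Z \<in> carrier_mat ?n ?n" using Y by (auto simp: Z_def YC_def)
  have data: "Fx S \<in> carrier_mat (ncon S) ?n" "Fu S \<in> carrier_mat (ncon S) (Nu S)"
    "Fw S \<in> carrier_mat (ncon S) ?n" "gvec S \<in> carrier_vec (ncon S)"
    and Rx: "Rx S \<in> carrier_mat ?n ?n" "(Rx S)\<^sup>T = Rx S"
    and Ru: "Ru S \<in> carrier_mat (Nu S) (Nu S)" "(Ru S)\<^sup>T = Ru S"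
    using system by (auto simp: netsys_ok_def psd_def)
  have state: "surrogate_state S Bt Lt Ht (ubar + Qw *\<^sub>v a + Q\<xi> *\<^sub>v b) a (vbar + Z *\<^sub>v b)
      = xbar + Pw *\<^sub>v a + P\<xi> *\<^sub>v b" if "a \<in> carrier_vec ?n" "b \<in> carrier_vec ?n" for a b
    unfolding xbar_eq Pw_eq P\<xi>_eq by (rule surrogate_affine[OF surrogate Qw Q\<xi> Zc ubar vbar that])
  note P = PiC_carrier[of S]
  have \<xi>_support: "vec_support ?n Pr \<xi> = ellipsoid ?n Sig"
    using vec_support_distr_cong[OF xi_ident] w_support by simp
  have contract: "PiC S *\<^sub>v (xbar + Pw *\<^sub>v a + P\<xi> *\<^sub>v b)
      \<in> (\<lambda>y. PiC S *\<^sub>v y) ` {vbar + y | y. y \<in> (\<lambda>z. Z *\<^sub>v z) ` ellipsoid ?n Sig}"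
    if a: "a \<in> ellipsoid ?n Sig" and b: "b \<in> ellipsoid ?n Sig" for a b
  proof -
    have ab: "Pw *\<^sub>v a \<in> carrier_vec ?n" "P\<xi> *\<^sub>v b \<in> carrier_vec ?n"
      using a b Pw P\<xi> by (auto simp: ellipsoid_def)
    obtain y where y: "y \<in> ellipsoid ?n Sig" "PiC S *\<^sub>v (Z *\<^sub>v y) = PiC S *\<^sub>v (Pw *\<^sub>v a + P\<xi> *\<^sub>v b)"
      using contract_constraint_satisfied[OF system Sigma Y Pw P\<xi> lam lmi a b] by (auto simp: Z_def)
    have Zy: "Z *\<^sub>v y \<in> carrier_vec ?n" using y Zc by (auto simp: ellipsoid_def)
    have "PiC S *\<^sub>v xbar - PiC S *\<^sub>v vbar = 0\<^sub>v (NxC S)"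
      using nominal mult_minus_distrib_mat_vec[OF P xbar vbar] by simp
    then have nom: "PiC S *\<^sub>v xbar = PiC S *\<^sub>v vbar"
      using P xbar vbar by (intro eq_vecI) (auto simp: vec_eq_iff simp del: index_mult_mat_vec)
    have "PiC S *\<^sub>v (xbar + Pw *\<^sub>v a + P\<xi> *\<^sub>v b) = PiC S *\<^sub>v (xbar + (Pw *\<^sub>v a + P\<xi> *\<^sub>v b))"
      using xbar ab by (simp add: assoc_add_vec[of _ ?n])
    also have "\<dots> = PiC S *\<^sub>v vbar + PiC S *\<^sub>v (Z *\<^sub>v y)"
      using mult_add_distrib_mat_vec[OF P xbar, of "Pw *\<^sub>v a + P\<xi> *\<^sub>v b"] ab nom y(2) by simp
    also have "\<dots> = PiC S *\<^sub>v (vbar + Z *\<^sub>v y)" by (rule mult_add_distrib_mat_vec[OF P vbar Zy, symmetric])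
    finally show ?thesis using y(1) by blast
  qed
  show "J_feasible S Bt Lt Ht (vec_support ?n Pr w) (vec_support ?n Pr \<xi>)
      Qw Q\<xi> (lam \<cdot>\<^sub>m 1\<^sub>m ?n - Y) ubar vbar"
    unfolding J_feasible_def w_support \<xi>_support Z_def[symmetric] Let_def
  proof (intro conjI ballI QN Q\<xi> ubar vbar)
    show "Z \<in> Zset S" unfolding Z_def by (rule contract_matrix_invertible(1)[OF Y lam(1)])
    show "Q\<xi> * minv Z \<in> QC S" unfolding Z_def by (rule QC_mult_contract_inverse[OF QC Y lam(1)])
    fix a b assume a: "a \<in> ellipsoid ?n Sig" and b: "b \<in> ellipsoid ?n Sig"
    then have ab: "a \<in> carrier_vec ?n" "b \<in> carrier_vec ?n" by (auto simp: ellipsoid_def)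
    show "PiC S *\<^sub>v surrogate_state S Bt Lt Ht (ubar + Qw *\<^sub>v a + Q\<xi> *\<^sub>v b) a (vbar + Z *\<^sub>v b)
        \<in> (\<lambda>y. PiC S *\<^sub>v y) ` {vbar + y | y. y \<in> (\<lambda>z. Z *\<^sub>v z) ` ellipsoid ?n Sig}"
      unfolding state[OF ab] by (rule contract[OF a b])
    show "Fx S *\<^sub>v surrogate_state S Bt Lt Ht (ubar + Qw *\<^sub>v a + Q\<xi> *\<^sub>v b) a (vbar + Z *\<^sub>v b)
        + Fu S *\<^sub>v (ubar + Qw *\<^sub>v a + Q\<xi> *\<^sub>v b) + Fw S *\<^sub>v a \<le> gvec S"
      unfolding state[OF ab]
      by (rule operational_constraint_satisfied[OF Sigma data Pw P\<xi> Qw Q\<xi> xbar ubar rows a b])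
  qed
  define M where "M = second_moment ?n Pr w"
  have M: "M \<in> carrier_mat ?n ?n" by (simp add: M_def second_moment_def)
  have carr: "w \<omega> \<in> carrier_vec ?n" "\<xi> \<omega> \<in> carrier_vec ?n" if "\<omega> \<in> space Pr" for \<omega>
    using measurable_space[OF w_rv that] measurable_space[OF xi_rv that] by simp_all
  note mom = iid_copy_moments[OF prob w_rv xi_rv Sigma w_support w_mean xi_indep xi_ident, folded M_def]
  have quad: "has_bochner_integral Pr
      (\<lambda>\<omega>. (c + P *\<^sub>v w \<omega> + Q *\<^sub>v \<xi> \<omega>) \<bullet> (R *\<^sub>v (c + P *\<^sub>v w \<omega> + Q *\<^sub>v \<xi> \<omega>)))
      (c \<bullet> (R *\<^sub>v c) + tr (P\<^sup>T * R * P * M) + tr (Q\<^sup>T * R * Q * M))"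
    if "R \<in> carrier_mat k k" "R\<^sup>T = R" "P \<in> carrier_mat k ?n" "Q \<in> carrier_mat k ?n" "c \<in> carrier_vec k"
    for R P Q c k
    by (rule has_bochner_integral_affine_quadratic
        [OF prob carr mom M second_moment_sym[of ?n Pr w, folded M_def] that])
  have "has_bochner_integral Pr (\<lambda>\<omega>.
        (xbar + Pw *\<^sub>v w \<omega> + P\<xi> *\<^sub>v \<xi> \<omega>) \<bullet> (Rx S *\<^sub>v (xbar + Pw *\<^sub>v w \<omega> + P\<xi> *\<^sub>v \<xi> \<omega>))
      + (ubar + Qw *\<^sub>v w \<omega> + Q\<xi> *\<^sub>v \<xi> \<omega>) \<bullet> (Ru S *\<^sub>v (ubar + Qw *\<^sub>v w \<omega> + Q\<xi> *\<^sub>v \<xi> \<omega>)))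
      ((xbar \<bullet> (Rx S *\<^sub>v xbar) + tr (Pw\<^sup>T * Rx S * Pw * M) + tr (P\<xi>\<^sup>T * Rx S * P\<xi> * M))
      + (ubar \<bullet> (Ru S *\<^sub>v ubar) + tr (Qw\<^sup>T * Ru S * Qw * M) + tr (Q\<xi>\<^sup>T * Ru S * Q\<xi> * M)))"
    by (rule has_bochner_integral_add[OF quad[OF Rx Pw P\<xi> xbar] quad[OF Ru Qw Q\<xi> ubar]])
  note val = has_bochner_integral_integral_eq[OF this]
  have "J_objective S Bt Lt Ht Pr w \<xi> Qw Q\<xi> Z ubar vbar
      = (xbar \<bullet> (Rx S *\<^sub>v xbar) + tr (Pw\<^sup>T * Rx S * Pw * M) + tr (P\<xi>\<^sup>T * Rx S * P\<xi> * M))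
      + (ubar \<bullet> (Ru S *\<^sub>v ubar) + tr (Qw\<^sup>T * Ru S * Qw * M) + tr (Q\<xi>\<^sup>T * Ru S * Q\<xi> * M))"
    unfolding J_objective_def Let_def
    by (subst val[symmetric], rule Bochner_Integration.integral_cong[OF refl]) (simp add: state carr)
  also have "\<dots> = S_objective S M Qw Q\<xi> ubar Pw P\<xi> xbar"
  proof -
    have "tr (P\<xi>\<^sup>T * Rx S * P\<xi> * M + Pw\<^sup>T * Rx S * Pw * M)
        = tr (P\<xi>\<^sup>T * Rx S * P\<xi> * M) + tr (Pw\<^sup>T * Rx S * Pw * M)"
      using P\<xi> Pw Rx M by (intro tr_add[of _ ?n]) auto
    moreover have "tr (Qw\<^sup>T * Ru S * Qw * M + Q\<xi>\<^sup>T * Ru S * Q\<xi> * M)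
        = tr (Qw\<^sup>T * Ru S * Qw * M) + tr (Q\<xi>\<^sup>T * Ru S * Q\<xi> * M)"
      using Q\<xi> Qw Ru M by (intro tr_add[of _ ?n]) auto
    ultimately show ?thesis by (simp add: S_objective_def)
  qed
  finally show "J_objective S Bt Lt Ht Pr w \<xi> Qw Q\<xi> (lam \<cdot>\<^sub>m 1\<^sub>m ?n - Y) ubar vbar
      = S_objective S (second_moment ?n Pr w) Qw Q\<xi> ubar Pw P\<xi> xbar"
    unfolding Z_def M_def .
qed

end
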